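(* Fix $n$. Let the displacement vectors be distributed as $D^n=(\mathcal{D}_1,\ldots,\mathcal{D}_n)$, where $\{\mathcal{D}_k\}$ is a centered, stationary and ergodic real-valued process, and assume $D^n$ has a density $f^n$ on $\mathbb{R}^n$ with $f^n(x)=f^n(-x)$. Let $\xi\in\mathbb{R}$, let $\mu^n$ be a homogeneous Poisson point process of intensity $\lambda_n$ on $\mathbb{R}^n$, and let $\widehat\mu^n$ be the Matérn-$\mathcal{D}$-$\xi$ point process built from $\mu^n$. Then the probability of error under maximum likelihood (MLE) decoding for the point process $\widehat\mu^n$ satisfies $$p_e(n)\le\int_{\mathbb{R}^n}\min\left(1,\ \lambda_n\int_{\mathbb{R}^n}1_{\mathbb{D}(y,0)\ge\xi}\,1_{\mathbb{D}(x,y)\le\mathbb{D}(x,0)}\,dy\right)f^n(x)\,dx.$$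
   Context: For $s,t\in\mathbb{R}^n$, $\mathbb{D}(s,t)=-\frac1n\ln f^n(s-t)\in\mathbb{R}\cup\{+\infty\}$. The Matérn-$\mathcal{D}$-$\xi$ point process $\widehat\mu^n$ is obtained from the Poisson process $\mu^n$ by discarding every point $T$ for which there is another point $S\neq T$ of $\mu^n$ with $\mathbb{D}(T,S)<\xi$. Write $\widehat\mu^n=\sum_k\epsilon_{T_k^n}$; each point carries a displacement vector $D_k^n$, i.i.d. in $k$ with law that of $D^n$, independent of $\widehat\mu^n$. MLE decoding: the decoding region $\mathcal{L}_k^n$ of $T_k^n$ consists of those $x$ with $\mathbb{D}(x,T_k^n)<\inf_{l\ne k}\mathbb{D}(x,T_l^n)$, together with those ambiguous locations $x$ (for which no point is such a strict minimizer) lying in the Euclidean Voronoi cell of $T_k^n$. The probability of error is $p_e(n)=\widehat{\mathbb{P}}_0^n(D_0^n\notin\mathcal{L}_0^n)$, with $\widehat{\mathbb{P}}_0^n$ the Palm probability of $\widehat\mu^n$ ($T_0^n=0$). *)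

theory Defs
  imports "HOL-Probability.Probability"
begin

section \<open>Real-valued processes in discrete time\<close>

abbreviation seq_borel :: "(nat \<Rightarrow> 'a::topological_space) measure" where
  "seq_borel \<equiv> PiM UNIV (\<lambda>_. borel)"

definition process_law :: "'w measure \<Rightarrow> (nat \<Rightarrow> 'w \<Rightarrow> real) \<Rightarrow> (nat \<Rightarrow> real) measure" where
  "process_law P X = distr P seq_borel (\<lambda>\<omega> k. X k \<omega>)"

definition stationary_process :: "'w measure \<Rightarrow> (nat \<Rightarrow> 'w \<Rightarrow> real) \<Rightarrow> bool" where
  "stationary_process P X \<longleftrightarrow>
     (\<forall>k. X k \<in> borel_measurable P) \<and>
     process_law P (\<lambda>k. X (Suc k)) = process_law P X"

definition ergodic_process :: "'w measure \<Rightarrow> (nat \<Rightarrow> 'w \<Rightarrow> real) \<Rightarrow> bool" where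
  "ergodic_process P X \<longleftrightarrow>
     (\<forall>A\<in>sets seq_borel. (\<lambda>x k. x (Suc k)) -` A = A \<longrightarrow>
        measure (process_law P X) A = 0 \<or> measure (process_law P X) A = 1)"

definition centered_process :: "'w measure \<Rightarrow> (nat \<Rightarrow> 'w \<Rightarrow> real) \<Rightarrow> bool" where
  "centered_process P X \<longleftrightarrow>
     (\<forall>k. integrable P (X k) \<and> integral\<^sup>L P (X k) = 0)"

section \<open>Point processes\<close>

text \<open>
  A simple point process on a Euclidean space is represented by its random support, a locally
  finite random set. The explicit Poisson probabilities also cover Borel sets of measure zero,
  whereas \<^term>\<open>poisson_pmf\<close> is only meaningful for a positive rate.
\<close>

definition poisson_process ::
  "'w measure \<Rightarrow> real \<Rightarrow> ('w \<Rightarrow> 'a::euclidean_space set) \<Rightarrow> bool" where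
  "poisson_process M lam N \<longleftrightarrow>
     (\<forall>\<omega>\<in>space M. \<forall>B. bounded B \<longrightarrow> finite (N \<omega> \<inter> B)) \<and>
     (\<forall>B\<in>sets borel. bounded B \<longrightarrow>
        (\<lambda>\<omega>. card (N \<omega> \<inter> B)) \<in> measurable M (count_space UNIV) \<and>
        (\<forall>k. measure M {\<omega>\<in>space M. card (N \<omega> \<inter> B) = k} =
             (lam * measure lborel B) ^ k / fact k * exp (- (lam * measure lborel B)))) \<and>
     (\<forall>(I::nat set) B. finite I \<and> disjoint_family_on B I \<and>
        (\<forall>i\<in>I. B i \<in> sets borel \<and> bounded (B i)) \<longrightarrow>
        prob_space.indep_vars M (\<lambda>_. count_space UNIV) (\<lambda>i \<omega>. card (N \<omega> \<inter> B i)) I)"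

text \<open>
  A marked point process is a random set of pairs (point, mark). Its Palm probability is
  the expected sum, over the pairs \<open>(t, d)\<close> of \<open>\<Phi>\<close> with \<open>t \<in> B\<close>, of the indicators of \<open>\<theta>\<^sub>t \<Phi> \<in> \<Gamma>\<close>,
  divided by \<open>\<lambda> |B|\<close>,
  where \<open>\<theta>\<^sub>t\<close> moves the point \<open>t\<close> to the origin and leaves the marks unchanged, \<open>B\<close> is the unit
  cube and \<open>\<lambda>\<close> is the intensity, i.e. the mean number of points in \<open>B\<close>. The probabilities of
  events are \<^typ>\<open>ennreal\<close>-valued.
\<close>

definition recentre :: "'a::euclidean_space \<Rightarrow> ('a \<times> 'b) set \<Rightarrow> ('a \<times> 'b) set" where
  "recentre t \<phi> = (\<lambda>(s, d). (s - t, d)) ` \<phi>"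

definition intensity :: "'w measure \<Rightarrow> ('w \<Rightarrow> ('a::euclidean_space \<times> 'b) set) \<Rightarrow> ennreal" where
  "intensity M \<Phi> =
     (\<integral>\<^sup>+\<omega>. (\<integral>\<^sup>+(t, d). indicator (cbox 0 One) t \<partial>count_space (\<Phi> \<omega>)) \<partial>M)"

definition palm_prob ::
  "'w measure \<Rightarrow> ('w \<Rightarrow> ('a::euclidean_space \<times> 'b) set) \<Rightarrow> ('a \<times> 'b) set set \<Rightarrow> ennreal" where
  "palm_prob M \<Phi> \<Gamma> =
     (\<integral>\<^sup>+\<omega>. (\<integral>\<^sup>+(t, d). indicator (cbox 0 One) t * indicator \<Gamma> (recentre t (\<Phi> \<omega>))
        \<partial>count_space (\<Phi> \<omega>)) \<partial>M) / intensity M \<Phi>"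

section \<open>The Matern process and maximum likelihood decoding\<close>

definition DD :: "(real ^ 'n \<Rightarrow> real) \<Rightarrow> real ^ 'n \<Rightarrow> real ^ 'n \<Rightarrow> ereal" where
  "DD f s t = (if f (s - t) = 0 then \<infinity> else ereal (- (1 / real CARD('n)) * ln (f (s - t))))"

definition matern :: "(real ^ 'n \<Rightarrow> real) \<Rightarrow> real \<Rightarrow> (real ^ 'n) set \<Rightarrow> (real ^ 'n) set" where
  "matern f \<xi> X = {t\<in>X. \<not> (\<exists>s\<in>X. s \<noteq> t \<and> DD f t s < ereal \<xi>)}"

text \<open>
  The cell is open: a location with two nearest points lies in no cell. Together with the strict
  inequality in \<open>strict_ml\<close> this makes the decoding regions disjoint, and it counts such ties as
  decoding errors.
\<close>

definition voronoi_cell :: "(real ^ 'n) set \<Rightarrow> real ^ 'n \<Rightarrow> (real ^ 'n) set" where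
  "voronoi_cell X t = {x. \<forall>s\<in>X - {t}. dist x t < dist x s}"

definition strict_ml :: "(real ^ 'n \<Rightarrow> real) \<Rightarrow> (real ^ 'n) set \<Rightarrow> real ^ 'n \<Rightarrow> (real ^ 'n) set" where
  "strict_ml f X t = {x. DD f x t < (INF s\<in>X - {t}. DD f x s)}"

definition decoding_region ::
  "(real ^ 'n \<Rightarrow> real) \<Rightarrow> (real ^ 'n) set \<Rightarrow> real ^ 'n \<Rightarrow> (real ^ 'n) set" where
  "decoding_region f X t =
     strict_ml f X t \<union> {x\<in>voronoi_cell X t. \<forall>s\<in>X. x \<notin> strict_ml f X s}"

text \<open>
  Under the Palm probability the transmitted point is the origin, so the received location is the
  mark of the origin.
\<close>

definition error_prob ::
  "'w measure \<Rightarrow> (real ^ 'n \<Rightarrow> real) \<Rightarrow> ('w \<Rightarrow> ((real ^ 'n) \<times> (real ^ 'n)) set) \<Rightarrow> ennreal" where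
  "error_prob M f \<Phi> =
     palm_prob M \<Phi> {\<phi>. \<exists>d. (0, d) \<in> \<phi> \<and> d \<notin> decoding_region f (fst ` \<phi>) 0}"

text \<open>
  \<open>T\<close> enumerates almost surely without repetition the points of a point process \<open>X\<close> (for the
  Matern process there are almost surely infinitely many), and the marks \<open>D\<close> are i.i.d. with law
  \<open>L\<close>, independent of the points. Independence from the enumeration \<open>T\<close>, rather than only from
  the unordered set \<open>X\<close>, excludes numberings of the points that look at the marks.
\<close>

definition iid_marking ::
  "'w measure \<Rightarrow> ('w \<Rightarrow> 'a::euclidean_space set) \<Rightarrow> 'a measure \<Rightarrow>
   (nat \<Rightarrow> 'w \<Rightarrow> 'a) \<Rightarrow> (nat \<Rightarrow> 'w \<Rightarrow> 'a) \<Rightarrow> bool" where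
  "iid_marking M X L T D \<longleftrightarrow>
     (\<forall>k. T k \<in> borel_measurable M) \<and>
     (AE \<omega> in M. inj (\<lambda>k. T k \<omega>) \<and> range (\<lambda>k. T k \<omega>) = X \<omega>) \<and>
     prob_space.indep_vars M (\<lambda>_. borel) D UNIV \<and>
     (\<forall>k. distr M borel (D k) = L) \<and>
     prob_space.indep_var M seq_borel (\<lambda>\<omega> k. T k \<omega>) seq_borel (\<lambda>\<omega> k. D k \<omega>)"

definition marked_points ::
  "(nat \<Rightarrow> 'w \<Rightarrow> 'a) \<Rightarrow> (nat \<Rightarrow> 'w \<Rightarrow> 'b) \<Rightarrow> 'w \<Rightarrow> ('a \<times> 'b) set" where
  "marked_points T D \<omega> = range (\<lambda>k. (T k \<omega>, D k \<omega>))"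

end

theory Submission
  imports Defs
begin

text \<open>
  Write \<open>K\<close> for the set of \<open>y\<close> with \<open>DD f y 0 < \<xi>\<close> and \<open>A\<close> for the set of \<open>y \<notin> K\<close> with
  \<open>DD f d y \<le> DD f d 0\<close>. By Mecke's formula the mean number of points \<open>t\<close> of \<open>N\<close> in the unit cube
  such that \<open>t + B\<close> contains no other point is \<open>lam * exp (- lam |B|)\<close>. For \<open>B = K\<close> this is the intensity
  of the Matern process. If a retained point with displacement \<open>d\<close> is decoded wrongly, then
  \<open>t + K\<close> is empty and \<open>t + A\<close> is not (up to the limit below). Subtracting the formula for \<open>K \<union> A\<close> from the one
  for \<open>K\<close> gives the intensity times \<open>1 - exp (- lam |A|) \<le> min 1 (lam |A|)\<close>, and integrating over \<open>d\<close>
  gives the theorem.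

  The infimum over the competitors need not be attained. A decoding error only yields competitors
  with \<open>f (d - y) > c * f d\<close> for each \<open>c < 1\<close>. Those sets have finite volume and decrease to \<open>A\<close> as
  \<open>c\<close> tends to 1.
\<close>

section \<open>Configurations and void events\<close>

lemma le_card_iff_disjoint_basis:
  fixes A :: "'a::metric_space set"
  assumes "finite A" and B: "topological_basis B"
  shows "k \<le> card A \<longleftrightarrow>
    (\<exists>F. finite F \<and> F \<subseteq> B \<and> card F = k \<and> disjoint F \<and> (\<forall>U\<in>F. A \<inter> U \<noteq> {}))"
proof
  assume "k \<le> card A"
  then obtain A' where A': "A' \<subseteq> A" "card A' = k"
    by (metis obtain_subset_with_card_n)
  have fin: "finite A'" using A' assms finite_subset by blast
  have "\<forall>x. \<exists>\<delta>>0. \<forall>y\<in>A'. y \<noteq> x \<longrightarrow> \<delta> \<le> dist x y"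
    using finite_set_avoid[OF fin] by blast
  then obtain e where e: "\<And>x. 0 < e x" "\<And>x y. y \<in> A' \<Longrightarrow> y \<noteq> x \<Longrightarrow> e x \<le> dist x y"
    by metis
  have "\<exists>U\<in>B. x \<in> U \<and> U \<subseteq> ball x (e x / 2)" for x
    using topological_basisE[OF B open_ball, of x x "e x / 2"] e(1)[of x] by auto
  then obtain U where U: "\<And>x. U x \<in> B" "\<And>x. x \<in> U x" "\<And>x. U x \<subseteq> ball x (e x / 2)"
    by metis
  have dis: "U x \<inter> U y = {}" if "x \<in> A'" "y \<in> A'" "x \<noteq> y" for x y
  proof (rule ccontr)
    assume "U x \<inter> U y \<noteq> {}"
    then obtain z where "dist x z < e x / 2" "dist y z < e y / 2"
      using U(3) by (fastforce simp: subset_eq)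
    moreover have "e x \<le> dist x y" "e y \<le> dist x y"
      using e(2)[of y x] e(2)[of x y] that by (auto simp: dist_commute[of y x])
    ultimately show False
      using dist_triangle2[of x y z] by linarith
  qed
  have "inj_on U A'"
    using dis U(2) by (intro inj_onI) (metis disjoint_iff)
  moreover have "disjoint (U ` A')"
    using dis by (auto simp: disjoint_def)
  moreover have "\<forall>V\<in>U ` A'. A \<inter> V \<noteq> {}"
    using A' U(2) by auto
  ultimately show "\<exists>F. finite F \<and> F \<subseteq> B \<and> card F = k \<and> disjoint F \<and> (\<forall>U\<in>F. A \<inter> U \<noteq> {})"
    using fin U(1) A'(2) by (intro exI[of _ "U ` A'"]) (auto simp: card_image)
next
  assume "\<exists>F. finite F \<and> F \<subseteq> B \<and> card F = k \<and> disjoint F \<and> (\<forall>U\<in>F. A \<inter> U \<noteq> {})"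
  then obtain F where F: "card F = k" "disjoint F" "\<forall>U\<in>F. A \<inter> U \<noteq> {}"
    by blast
  then have "\<forall>U\<in>F. \<exists>x. x \<in> A \<inter> U"
    by blast
  then obtain p where p: "\<And>U. U \<in> F \<Longrightarrow> p U \<in> A \<inter> U"
    by metis
  have "inj_on p F"
    using p F(2) by (intro inj_onI) (metis IntD2 disjointD disjoint_iff)
  with p F(1) assms(1) show "k \<le> card A"
    using card_inj_on_le[of p F A] by auto
qed

definition locally_finite_sets :: "'a::metric_space set set" where
  "locally_finite_sets = {\<phi>. \<forall>B. bounded B \<longrightarrow> finite (\<phi> \<inter> B)}"

lemma locally_finite_sets_Diff: "\<phi> \<in> locally_finite_sets \<Longrightarrow> \<phi> - A \<in> locally_finite_sets"
  unfolding locally_finite_sets_def by (auto intro: finite_subset[of "(\<phi> - A) \<inter> _" "\<phi> \<inter> _"])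

definition void_event :: "'a::metric_space set \<Rightarrow> 'a set set" where
  "void_event C = {\<phi> \<in> locally_finite_sets. \<phi> \<inter> C = {}}"

text \<open>
  By Renyi's observation a simple point configuration is determined by the sets that it avoids,
  so void events already generate the counting sigma-algebra. Unlike the events prescribing one
  count, they are stable under intersection.
\<close>

definition configs :: "'a::euclidean_space set measure" where
  "configs = sigma locally_finite_sets {void_event C | C. C \<in> sets borel \<and> bounded C}"

lemma void_generator_closed:
  "{void_event C | C. C \<in> sets borel \<and> bounded C} \<subseteq> Pow locally_finite_sets"
  by (auto simp: void_event_def)

lemma space_configs [simp]: "space configs = locally_finite_sets"
  unfolding configs_def by (simp add: void_generator_closed space_measure_of)

lemma sets_configs:
  "sets configs =
    sigma_sets locally_finite_sets {void_event C | C. C \<in> sets borel \<and> bounded C}"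
  unfolding configs_def by (simp add: void_generator_closed sets_measure_of)

lemma void_event_sets: "C \<in> sets borel \<Longrightarrow> bounded C \<Longrightarrow> void_event C \<in> sets configs"
  unfolding sets_configs by (auto intro!: sigma_sets.Basic)

lemma Int_stable_void:
  "Int_stable {void_event C | C :: 'a::euclidean_space set. C \<in> sets borel \<and> bounded C}"
proof (rule Int_stableI, clarify)
  fix C D :: "'a set"
  assume "C \<in> sets borel" "bounded C" "D \<in> sets borel" "bounded D"
  then show "\<exists>E. void_event C \<inter> void_event D = void_event E \<and> E \<in> sets borel \<and> bounded E"
    by (intro exI[of _ "C \<union> D"]) (auto simp: void_event_def)
qed

lemma measurable_card_configs [measurable]:
  fixes R :: "'a::euclidean_space set"
  assumes R: "R \<in> sets borel" "bounded R"
  shows "(\<lambda>\<phi>. card (\<phi> \<inter> R)) \<in> measurable configs (count_space UNIV)"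
proof -
  obtain B :: "'a set set" where B: "countable B" "topological_basis B"
    using ex_countable_basis by blast
  define FF where "FF k = {F. (finite F \<and> F \<subseteq> B) \<and> card F = k \<and> disjoint F}" for k
  have cnt: "countable (FF k)" for k
    unfolding FF_def
    by (rule countable_subset[OF _ countable_Collect_finite_subset[OF B(1)]]) auto
  have Bopen: "U \<in> sets borel" if "U \<in> B" for U
    using topological_basis_open[OF B(2) that] by simp
  have ge: "{\<phi> \<in> locally_finite_sets. k \<le> card (\<phi> \<inter> R)} \<in> sets configs" for k
  proof -
    have "{\<phi> \<in> locally_finite_sets. k \<le> card (\<phi> \<inter> R)} =
      (\<Union>F\<in>FF k. {\<phi> \<in> space configs. \<forall>U\<in>F. \<phi> \<in> space configs - void_event (R \<inter> U)})"
    proof -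
      have "k \<le> card (\<phi> \<inter> R) \<longleftrightarrow>
          (\<exists>F\<in>FF k. \<forall>U\<in>F. \<phi> \<in> space configs - void_event (R \<inter> U))"
        if "\<phi> \<in> locally_finite_sets" for \<phi>
      proof -
        have "finite (\<phi> \<inter> R)"
          using that R(2) by (simp add: locally_finite_sets_def)
        then show ?thesis
          unfolding le_card_iff_disjoint_basis[OF \<open>finite (\<phi> \<inter> R)\<close> B(2)] FF_def
          using that by (simp add: void_event_def Int_assoc Bex_def conj_assoc)
      qed
      then show ?thesis by auto
    qed
    moreover have "{\<phi> \<in> space configs. \<forall>U\<in>F. \<phi> \<in> space configs - void_event (R \<inter> U)}
      \<in> sets configs" if "F \<in> FF k" for F
    proof (rule sets.sets_Collect_finite_All)
      show "finite F" using that by (auto simp: FF_def)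
      fix U assume "U \<in> F"
      then have "R \<inter> U \<in> sets borel" "bounded (R \<inter> U)"
        using that Bopen R by (auto simp: FF_def bounded_Int)
      then have "space configs - void_event (R \<inter> U) \<in> sets configs"
        by (intro sets.compl_sets void_event_sets)
      then show "{\<phi> \<in> space configs. \<phi> \<in> space configs - void_event (R \<inter> U)} \<in> sets configs"
        by (simp add: set_diff_eq)
    qed
    ultimately show ?thesis
      using cnt by (auto intro!: sets.countable_UN')
  qed
  have "(\<lambda>\<phi>. card (\<phi> \<inter> R)) -` {k} \<inter> space configs =
      {\<phi> \<in> locally_finite_sets. k \<le> card (\<phi> \<inter> R)} -
      {\<phi> \<in> locally_finite_sets. Suc k \<le> card (\<phi> \<inter> R)}" for k
    by auto
  then show ?thesis
    using ge by (auto simp: measurable_count_space_eq2_countable)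
qed

lemma nn_integral_indicator_count_space:
  "finite A \<Longrightarrow> (\<integral>\<^sup>+x. indicator C x \<partial>count_space A) = of_nat (card (A \<inter> C))"
  by (simp add: nn_integral_count_space_finite indicator_def sum.If_cases Int_def
      flip: of_nat_sum)

lemma ennreal_of_nat_diff: "n \<le> m \<Longrightarrow> (of_nat (m - n) :: ennreal) = of_nat m - of_nat n"
  by (simp add: ennreal_of_nat_eq_real_of_nat of_nat_diff ennreal_minus)

lemma measurable_count_section:
  fixes R :: "'a::euclidean_space set"
  assumes R: "R \<in> sets borel" "bounded R" and H: "H \<in> sets (borel \<Otimes>\<^sub>M borel)"
  shows "(\<lambda>(t::'b::second_countable_topology, \<phi>). \<integral>\<^sup>+s. indicator H (t, s) \<partial>count_space (\<phi> \<inter> R))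
    \<in> borel_measurable (borel \<Otimes>\<^sub>M configs)"
  using Int_stable_pair_measure_generator pair_measure_closed H
  unfolding sets_pair_measure[where A = "borel::'b measure" and B = "borel::'a measure"]
proof (induct rule: sigma_sets_induct_disjoint)
  have fin: "finite (\<phi> \<inter> R)" if "\<phi> \<in> locally_finite_sets" for \<phi>
    using that R by (auto simp: locally_finite_sets_def)
  have cardm: "(\<lambda>(t::'b, \<phi>). of_nat (card (\<phi> \<inter> C)) :: ennreal)
      \<in> borel_measurable (borel \<Otimes>\<^sub>M configs)" if "C \<in> sets borel" "bounded C" for C
    using measurable_card_configs[OF that] by measurable
  {
    case (basic H)
    then obtain C1 C2 where H: "H = C1 \<times> C2" "C1 \<in> sets borel" "C2 \<in> sets borel"
      by blast
    note [measurable] = H(2)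
    have [measurable]: "(\<lambda>x::'b \<times> 'a set. of_nat (card (snd x \<inter> (R \<inter> C2))) :: ennreal)
      \<in> borel_measurable (borel \<Otimes>\<^sub>M configs)"
      using cardm[of "R \<inter> C2"] H R by (simp add: bounded_Int split_beta')
    have "(\<lambda>(t, \<phi>). indicator C1 t * of_nat (card (\<phi> \<inter> (R \<inter> C2))) :: ennreal)
      \<in> borel_measurable (borel \<Otimes>\<^sub>M configs)"
      by (simp add: split_beta')
    then show ?case
      using fin by (subst measurable_cong[where g = "\<lambda>(t, \<phi>). indicator C1 t * of_nat (card (\<phi> \<inter> (R \<inter> C2)))"])
        (auto simp: H space_pair_measure indicator_times nn_integral_cmult
          nn_integral_indicator_count_space Int_assoc)
  next
    case empty
    show ?case by simp
  next
    case (compl H)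
    have "(\<lambda>(t, \<phi>). of_nat (card (\<phi> \<inter> R)) - (\<integral>\<^sup>+s. indicator H (t, s) \<partial>count_space (\<phi> \<inter> R)))
      \<in> borel_measurable (borel \<Otimes>\<^sub>M configs)"
      using cardm[OF R] compl(2) by (simp add: split_beta')
    moreover have "(\<integral>\<^sup>+s. indicator (space borel \<times> space borel - H) (t, s) \<partial>count_space (\<phi> \<inter> R)) =
        of_nat (card (\<phi> \<inter> R)) - (\<integral>\<^sup>+s. indicator H (t, s) \<partial>count_space (\<phi> \<inter> R))"
      if "\<phi> \<in> locally_finite_sets" for t \<phi>
    proof -
      have "(\<integral>\<^sup>+s. indicator (space borel \<times> space borel - H) (t, s) \<partial>count_space (\<phi> \<inter> R)) =
        (\<integral>\<^sup>+s. indicator (- Pair t -` H) s \<partial>count_space (\<phi> \<inter> R))"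
        by (intro nn_integral_cong) (auto split: split_indicator)
      moreover have "(\<integral>\<^sup>+s. indicator H (t, s) \<partial>count_space (\<phi> \<inter> R)) =
        (\<integral>\<^sup>+s. indicator (Pair t -` H) s \<partial>count_space (\<phi> \<inter> R))"
        by (intro nn_integral_cong) (auto split: split_indicator)
      moreover have "card (\<phi> \<inter> R \<inter> - Pair t -` H) = card (\<phi> \<inter> R) - card (\<phi> \<inter> R \<inter> Pair t -` H)"
        using fin[OF that] by (metis Diff_eq card_Diff_subset_Int finite_Int)
      ultimately show ?thesis
        using fin[OF that]
        by (simp add: nn_integral_indicator_count_space
            ennreal_of_nat_diff[OF card_mono[OF _ Int_lower1]])
    qed
    ultimately show ?case
      by (subst measurable_cong[where g = "\<lambda>(t, \<phi>). of_nat (card (\<phi> \<inter> R)) -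
          (\<integral>\<^sup>+s. indicator H (t, s) \<partial>count_space (\<phi> \<inter> R))"])
        (auto simp: space_pair_measure)
  next
    case (union A)
    have "(\<integral>\<^sup>+s. indicator (\<Union>i. A i) (t, s) \<partial>count_space (\<phi> \<inter> R)) =
      (\<Sum>i. \<integral>\<^sup>+s. indicator (A i) (t, s) \<partial>count_space (\<phi> \<inter> R))" for t \<phi>
      using union(1) by (subst nn_integral_suminf[symmetric])
        (auto intro!: nn_integral_cong simp: suminf_indicator)
    then show ?case
      using union(3) by (simp add: split_beta')
  }
qed

lemma sets_void_section:
  fixes H :: "('b::second_countable_topology \<times> 'a::euclidean_space) set"
  assumes H: "H \<in> sets (borel \<Otimes>\<^sub>M borel)"
  shows "{(t, \<phi>). \<phi> \<in> locally_finite_sets \<and> (\<forall>s\<in>\<phi>. (t, s) \<notin> H)} \<in> sets (borel \<Otimes>\<^sub>M configs)"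
proof -
  define c where "c n = (\<lambda>(t::'b, \<phi>). \<integral>\<^sup>+s. indicator H (t, s) \<partial>count_space (\<phi> \<inter> cball 0 (real n)))" for n
  have [measurable]: "c n \<in> borel_measurable (borel \<Otimes>\<^sub>M configs)" for n
    unfolding c_def by (rule measurable_count_section[OF _ _ H]) auto
  have "(\<forall>s\<in>\<phi>. (t, s) \<notin> H) \<longleftrightarrow> (\<forall>n. c n (t, \<phi>) = 0)" for t \<phi>
  proof -
    have "c n (t, \<phi>) = 0 \<longleftrightarrow> (\<forall>s\<in>\<phi> \<inter> cball 0 (real n). (t, s) \<notin> H)" for n
      unfolding c_def by (auto simp: nn_integral_0_iff_AE AE_count_space indicator_eq_0_iff)
    moreover have "\<exists>n. s \<in> cball 0 (real n)" for s :: 'a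
      using real_arch_simple[of "norm s"] by auto
    ultimately show ?thesis by blast
  qed
  then have "{(t, \<phi>). \<phi> \<in> locally_finite_sets \<and> (\<forall>s\<in>\<phi>. (t, s) \<notin> H)} =
    {x \<in> space (borel \<Otimes>\<^sub>M configs). \<forall>n. c n x = 0}"
    by (auto simp: space_pair_measure)
  also have "\<dots> \<in> sets (borel \<Otimes>\<^sub>M configs)"
    by measurable
  finally show ?thesis .
qed

section \<open>Mecke formula for the Poisson process\<close>

lemma sums_poisson_mean:
  "(\<lambda>k. real k * (x ^ k / fact k * exp (- x))) sums (x :: real)"
proof -
  have "(\<lambda>k. x * exp (- x) * (x ^ k / fact k)) sums (x * exp (- x) * exp x)"
    using exp_converges[of x] by (intro sums_mult) (simp add: field_simps)
  moreover have "x * exp (- x) * exp x = x"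
    by (simp add: exp_minus)
  moreover have "x * exp (- x) * (x ^ k / fact k) =
      real (Suc k) * (x ^ Suc k / fact (Suc k) * exp (- x))" for k
  proof -
    have "real (Suc k) / fact (Suc k) = 1 / (fact k :: real)"
      unfolding fact_Suc by (simp del: of_nat_Suc)
    then have "x ^ Suc k * exp (- x) * (real (Suc k) / fact (Suc k)) =
        x ^ Suc k * exp (- x) * (1 / fact k)"
      by simp
    then show ?thesis
      by (simp add: mult_ac del: of_nat_Suc fact_Suc)
  qed
  ultimately have "(\<lambda>k. real (Suc k) * (x ^ Suc k / fact (Suc k) * exp (- x))) sums x"
    by (simp only:)
  then show ?thesis
    by (subst (asm) sums_Suc_iff) simp
qed

lemma emeasure_lborel_vimage_diff:
  fixes B :: "'a::euclidean_space set"
  assumes "B \<in> sets borel"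
  shows "emeasure lborel {s. s - t \<in> B} = emeasure lborel B"
proof -
  have "emeasure lborel B = emeasure (distr lborel borel ((+) (- t))) B"
    by (simp add: lborel_distr_plus)
  also have "\<dots> = emeasure lborel {s. s - t \<in> B}"
    using assms by (subst emeasure_distr) (auto intro!: arg_cong[where f = "emeasure lborel"])
  finally show ?thesis by simp
qed

lemma sets_vimage_diff:
  fixes B :: "'a::euclidean_space set"
  shows "B \<in> sets borel \<Longrightarrow> {s. s - t \<in> B} \<in> sets borel"
  by (rule measurable_sets_borel[of "\<lambda>s. s - t" borel B, unfolded vimage_def]) auto

lemma measure_lborel_split:
  fixes V C :: "'b::euclidean_space set"
  assumes "V \<in> sets borel" "bounded V" "C \<in> sets borel"
  shows "measure lborel V = measure lborel (V - C) + measure lborel (V \<inter> C)"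
proof -
  have "measure lborel ((V - C) \<union> (V \<inter> C)) = measure lborel (V - C) + measure lborel (V \<inter> C)"
  proof (rule measure_Union)
    have "bounded (V - C)" "bounded (V \<inter> C)"
      using assms(2) by (auto intro: bounded_subset)
    then show "emeasure lborel (V - C) \<noteq> \<infinity>" "emeasure lborel (V \<inter> C) \<noteq> \<infinity>"
      using emeasure_bounded_finite by (metis infinity_ennreal_def less_irrefl)+
  qed (use assms in auto)
  moreover have "(V - C) \<union> (V \<inter> C) = V"
    by blast
  ultimately show ?thesis by simp
qed

locale poisson = prob_space M for M :: "'w measure" +
  fixes lam :: real and N :: "'w \<Rightarrow> 'a::euclidean_space set"
  assumes lam_pos: "0 < lam" and poisson_N: "poisson_process M lam N"
begin

lemma N_locally_finite: "\<omega> \<in> space M \<Longrightarrow> N \<omega> \<in> locally_finite_sets"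
  using poisson_N unfolding poisson_process_def locally_finite_sets_def by simp

lemma finite_N: "\<omega> \<in> space M \<Longrightarrow> bounded B \<Longrightarrow> finite (N \<omega> \<inter> B)"
  using poisson_N unfolding poisson_process_def by simp

lemma measurable_card_N:
  assumes "B \<in> sets borel" "bounded B"
  shows "(\<lambda>\<omega>. card (N \<omega> \<inter> B)) \<in> measurable M (count_space UNIV)"
  using poisson_N assms unfolding poisson_process_def by blast

lemma prob_card_N:
  assumes "B \<in> sets borel" "bounded B"
  shows "prob {\<omega>\<in>space M. card (N \<omega> \<inter> B) = k} =
    (lam * measure lborel B) ^ k / fact k * exp (- (lam * measure lborel B))"
  using poisson_N assms unfolding poisson_process_def by blast

lemma prob_card_N_disjoint:
  assumes "B \<in> sets borel" "bounded B" "C \<in> sets borel" "bounded C" "B \<inter> C = {}"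
  shows "prob {\<omega>\<in>space M. card (N \<omega> \<inter> B) = j \<and> card (N \<omega> \<inter> C) = k} =
    prob {\<omega>\<in>space M. card (N \<omega> \<inter> B) = j} * prob {\<omega>\<in>space M. card (N \<omega> \<inter> C) = k}"
proof -
  define D where "D i = (if i = (0::nat) then B else C)" for i
  have "indep_vars (\<lambda>_. count_space UNIV) (\<lambda>i \<omega>. card (N \<omega> \<inter> D i)) {0, 1}"
  proof -
    have "\<forall>(I::nat set) B. finite I \<and> disjoint_family_on B I \<and>
        (\<forall>i\<in>I. B i \<in> sets borel \<and> bounded (B i)) \<longrightarrow>
        indep_vars (\<lambda>_. count_space UNIV) (\<lambda>i \<omega>. card (N \<omega> \<inter> B i)) I"
      using poisson_N unfolding poisson_process_def by blast
    moreover have "disjoint_family_on D {0, 1}"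
      using assms(5) by (auto simp: D_def disjoint_family_on_def)
    moreover have "\<forall>i\<in>{0, 1}. D i \<in> sets borel \<and> bounded (D i)"
      using assms by (simp add: D_def)
    ultimately show ?thesis by simp
  qed
  from indep_varsD_finite[OF this, where A = "\<lambda>i. {if i = 0 then j else k}"]
  have "prob (\<Inter>i\<in>{0, 1}. (\<lambda>\<omega>. card (N \<omega> \<inter> D i)) -` {if i = 0 then j else k} \<inter> space M) =
      (\<Prod>i\<in>{0, 1}. prob ((\<lambda>\<omega>. card (N \<omega> \<inter> D i)) -` {if i = 0 then j else k} \<inter> space M))"
    by simp
  moreover have "(\<Inter>i\<in>{0, 1}. (\<lambda>\<omega>. card (N \<omega> \<inter> D i)) -` {if i = 0 then j else k} \<inter> space M) =
      {\<omega>\<in>space M. card (N \<omega> \<inter> B) = j \<and> card (N \<omega> \<inter> C) = k}"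
    by (auto simp: D_def)
  moreover have "(\<lambda>\<omega>. card (N \<omega> \<inter> E)) -` {l} \<inter> space M = {\<omega>\<in>space M. card (N \<omega> \<inter> E) = l}" for E l
    by auto
  ultimately show ?thesis
    by (simp add: D_def)
qed

lemma sets_card_N:
  assumes "B \<in> sets borel" "bounded B"
  shows "{\<omega>\<in>space M. card (N \<omega> \<inter> B) = k} \<in> events"
  using measurable_sets[OF measurable_card_N[OF assms], of "{k}"]
  by (simp add: vimage_def Int_def conj_commute)

lemma void_iff_card: "\<omega> \<in> space M \<Longrightarrow> bounded B \<Longrightarrow> N \<omega> \<inter> B = {} \<longleftrightarrow> card (N \<omega> \<inter> B) = 0"
  using finite_N by auto

lemma measurable_N: "N \<in> measurable M configs"
proof (rule measurable_sigma_sets[OF sets_configs void_generator_closed])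
  show "N \<in> space M \<rightarrow> locally_finite_sets"
    using N_locally_finite by auto
  fix V assume "V \<in> {void_event C |C :: 'a set. C \<in> sets borel \<and> bounded C}"
  then obtain C :: "'a set" where C: "V = void_event C" "C \<in> sets borel" "bounded C"
    by blast
  then have "N -` V \<inter> space M = {\<omega>\<in>space M. card (N \<omega> \<inter> C) = 0}"
    using N_locally_finite void_iff_card by (auto simp: void_event_def)
  then show "N -` V \<inter> space M \<in> events"
    using sets_card_N C by simp
qed

lemma sets_void_N:
  assumes "C \<in> sets borel"
  shows "{\<omega>\<in>space M. N \<omega> \<inter> C = {}} \<in> events"
proof -
  have "{\<omega>\<in>space M. N \<omega> \<inter> C = {}} =
      {\<omega>\<in>space M. \<forall>n. card (N \<omega> \<inter> (C \<inter> cball 0 (real n))) = 0}"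
  proof -
    have "\<exists>n. x \<in> cball 0 (real n)" for x :: 'a
      using real_arch_simple[of "norm x"] by auto
    then have "N \<omega> \<inter> C = {} \<longleftrightarrow> (\<forall>n. N \<omega> \<inter> (C \<inter> cball 0 (real n)) = {})" for \<omega>
      by blast
    moreover have "N \<omega> \<inter> (C \<inter> cball 0 (real n)) = {} \<longleftrightarrow> card (N \<omega> \<inter> (C \<inter> cball 0 (real n))) = 0"
      if "\<omega> \<in> space M" for n \<omega>
      using that by (intro void_iff_card) (auto simp: bounded_Int)
    ultimately show ?thesis
      by (intro Collect_cong) metis
  qed
  also have "\<dots> \<in> events"
    using assms by (intro sets.sets_Collect_countable_All sets_card_N) (auto simp: bounded_Int)
  finally show ?thesis .
qed

lemma prob_void_bounded:
  assumes "C \<in> sets borel" "bounded C"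
  shows "prob {\<omega>\<in>space M. N \<omega> \<inter> C = {}} = exp (- (lam * measure lborel C))"
proof -
  have "{\<omega>\<in>space M. N \<omega> \<inter> C = {}} = {\<omega>\<in>space M. card (N \<omega> \<inter> C) = 0}"
    using void_iff_card assms by auto
  then show ?thesis
    using prob_card_N[OF assms, of 0] by simp
qed

lemma prob_void:
  assumes C: "C \<in> sets borel" "emeasure lborel C < \<infinity>"
  shows "prob {\<omega>\<in>space M. N \<omega> \<inter> C = {}} = exp (- (lam * measure lborel C))"
proof -
  define Cn where "Cn n = C \<inter> cball 0 (real n)" for n
  have Cn: "Cn n \<in> sets borel" "bounded (Cn n)" for n
    using C(1) by (auto simp: Cn_def bounded_Int)
  have mono: "incseq Cn"
    by (auto simp: Cn_def incseq_def)
  have un: "(\<Union>n. Cn n) = C"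
    using real_arch_simple by (force simp: Cn_def)
  have "(\<lambda>n. measure lborel (Cn n)) \<longlonglongrightarrow> measure lborel (\<Union>n. Cn n)"
    using Cn mono C(2) un by (intro Lim_measure_incseq) (auto simp: less_top)
  then have "(\<lambda>n. exp (- (lam * measure lborel (Cn n)))) \<longlonglongrightarrow> exp (- (lam * measure lborel C))"
    unfolding un by (intro tendsto_intros)
  moreover have "(\<lambda>n. prob {\<omega>\<in>space M. N \<omega> \<inter> Cn n = {}})
      \<longlonglongrightarrow> prob (\<Inter>n. {\<omega>\<in>space M. N \<omega> \<inter> Cn n = {}})"
  proof (rule Lim_measure_decseq)
    show "range (\<lambda>n. {\<omega>\<in>space M. N \<omega> \<inter> Cn n = {}}) \<subseteq> events"
      using sets_void_N Cn by auto
    show "decseq (\<lambda>n. {\<omega>\<in>space M. N \<omega> \<inter> Cn n = {}})"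
      using mono by (fastforce simp: decseq_def incseq_def)
  qed simp
  moreover have "(\<Inter>n. {\<omega>\<in>space M. N \<omega> \<inter> Cn n = {}}) = {\<omega>\<in>space M. N \<omega> \<inter> C = {}}"
    using un by auto
  ultimately show ?thesis
    using prob_void_bounded[OF Cn] LIMSEQ_unique by auto
qed

lemma mean_card_void:
  assumes B: "B \<in> sets borel" "bounded B" and C: "C \<in> sets borel" "bounded C"
    and "B \<inter> C = {}"
  shows "(\<integral>\<^sup>+\<omega>. indicator {\<omega>\<in>space M. N \<omega> \<inter> C = {}} \<omega> * of_nat (card (N \<omega> \<inter> B)) \<partial>M) =
    ennreal (exp (- (lam * measure lborel C)) * (lam * measure lborel B))"
proof -
  let ?E = "\<lambda>k. {\<omega>\<in>space M. card (N \<omega> \<inter> B) = k \<and> card (N \<omega> \<inter> C) = 0}"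
  have E: "?E k \<in> events" for k
    using sets.Int[OF sets_card_N[OF B, of k] sets_card_N[OF C, of 0]]
    by (simp add: Int_def conj_ac cong: conj_cong)
  have "(\<integral>\<^sup>+\<omega>. indicator {\<omega>\<in>space M. N \<omega> \<inter> C = {}} \<omega> * of_nat (card (N \<omega> \<inter> B)) \<partial>M) =
      (\<integral>\<^sup>+\<omega>. (\<Sum>k. of_nat k * indicator (?E k) \<omega>) \<partial>M)"
  proof (rule nn_integral_cong)
    fix \<omega> assume \<omega>: "\<omega> \<in> space M"
    have "(\<Sum>k. of_nat k * indicator (?E k) \<omega> :: ennreal) =
        (\<Sum>k\<in>{card (N \<omega> \<inter> B)}. of_nat k * indicator (?E k) \<omega>)"
      by (rule suminf_finite) (auto simp: indicator_def)
    also have "\<dots> = indicator {\<omega>\<in>space M. N \<omega> \<inter> C = {}} \<omega> * of_nat (card (N \<omega> \<inter> B))"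
      using \<omega> void_iff_card[OF \<omega> C(2)] by (simp add: indicator_def)
    finally show "indicator {\<omega>\<in>space M. N \<omega> \<inter> C = {}} \<omega> * of_nat (card (N \<omega> \<inter> B)) =
        (\<Sum>k. of_nat k * indicator (?E k) \<omega> :: ennreal)" by simp
  qed
  also have "\<dots> = (\<Sum>k. of_nat k * emeasure M (?E k))"
    using E by (subst nn_integral_suminf) (auto simp: nn_integral_cmult)
  also have "\<dots> = (\<Sum>k. ennreal (exp (- (lam * measure lborel C)) *
      (real k * ((lam * measure lborel B) ^ k / fact k * exp (- (lam * measure lborel B))))))"
  proof -
    have "of_nat k * emeasure M (?E k) = ennreal (exp (- (lam * measure lborel C)) *
      (real k * ((lam * measure lborel B) ^ k / fact k * exp (- (lam * measure lborel B)))))" for k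
      unfolding emeasure_eq_measure prob_card_N_disjoint[OF B C assms(5)]
        prob_card_N[OF B] prob_card_N[OF C]
      by (simp add: ennreal_of_nat_eq_real_of_nat ennreal_mult'[symmetric] mult_ac)
    then show ?thesis by simp
  qed
  also have "\<dots> = ennreal (exp (- (lam * measure lborel C)) * (lam * measure lborel B))"
    using sums_mult[OF sums_poisson_mean] lam_pos
    by (intro suminf_ennreal_eq) (auto intro!: mult_nonneg_nonneg)
  finally show ?thesis .
qed

definition reduced_campbell :: "'a set \<Rightarrow> ('a \<times> 'a set) set \<Rightarrow> 'w \<Rightarrow> ennreal" where
  "reduced_campbell W S \<omega> = (\<integral>\<^sup>+t. indicator S (t, N \<omega> - {t}) \<partial>count_space (N \<omega> \<inter> W))"

definition mecke_measure :: "'a set \<Rightarrow> ('a \<times> 'a set) measure" where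
  "mecke_measure W = density lborel (\<lambda>t. ennreal lam * indicator W t) \<Otimes>\<^sub>M distr M configs N"

lemma sets_mecke_measure [simp]: "sets (mecke_measure W) = sets (borel \<Otimes>\<^sub>M configs)"
  unfolding mecke_measure_def by (intro sets_pair_measure_cong) simp_all

lemma prob_space_distr_N: "prob_space (distr M configs N)"
  by (rule prob_space_distr[OF measurable_N])

lemma emeasure_mecke_Times:
  assumes "W \<in> sets borel" "A \<in> sets borel" "V \<in> sets configs"
  shows "emeasure (mecke_measure W) (A \<times> V) =
    ennreal lam * emeasure lborel (W \<inter> A) * emeasure M (N -` V \<inter> space M)"
proof -
  interpret D: prob_space "distr M configs N"
    by (rule prob_space_distr_N)
  have "emeasure (density lborel (\<lambda>t. ennreal lam * indicator W t)) A =
      (\<integral>\<^sup>+t. ennreal lam * indicator (W \<inter> A) t \<partial>lborel)"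
    using assms by (subst emeasure_density)
      (auto intro!: nn_integral_cong simp: indicator_inter_arith mult_ac)
  then show ?thesis
    unfolding mecke_measure_def using assms measurable_N
    by (simp add: D.emeasure_pair_measure_Times nn_integral_cmult emeasure_distr)
qed

lemma emeasure_mecke_finite:
  assumes "W \<in> sets borel" "bounded W"
  shows "emeasure (mecke_measure W) S < \<infinity>"
proof -
  have "(locally_finite_sets :: 'a set set) \<in> sets configs"
    using sets.top[of configs] by simp
  then have "emeasure (mecke_measure W) (UNIV \<times> locally_finite_sets) < \<infinity>"
    using emeasure_bounded_finite[OF assms(2)] assms(1)
    by (simp add: emeasure_mecke_Times ennreal_mult_less_top emeasure_eq_measure)
  moreover have "emeasure (mecke_measure W) S \<le> emeasure (mecke_measure W) (UNIV \<times> locally_finite_sets)"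
    using emeasure_space[of "mecke_measure W" S]
    by (simp add: mecke_measure_def space_pair_measure)
  ultimately show ?thesis
    by (rule le_less_trans[rotated])
qed

text \<open>
  If \<open>C\<close> contains no point, every point of \<open>A \<inter> W\<close> is counted; if it contains exactly one, only
  that point can be counted, since removing it is what empties \<open>C\<close>.
\<close>

lemma reduced_campbell_void_pointwise:
  assumes W: "bounded W" and C: "bounded C" and \<omega>: "\<omega> \<in> space M"
  shows "reduced_campbell W (A \<times> void_event C) \<omega> =
    indicator {\<omega>\<in>space M. N \<omega> \<inter> C = {}} \<omega> * of_nat (card (N \<omega> \<inter> (A \<inter> W - C))) +
    indicator {\<omega>\<in>space M. card (N \<omega> \<inter> (A \<inter> W \<inter> C)) = 1 \<and> card (N \<omega> \<inter> (C - A \<inter> W)) = 0} \<omega>"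
proof -
  define X where "X = N \<omega>"
  have fin: "finite (X \<inter> W)" "finite (X \<inter> C)"
    using finite_N[OF \<omega>] W C by (auto simp: X_def)
  have sub: "finite (X \<inter> D)" if "D \<subseteq> C" for D
    by (rule finite_subset[OF _ fin(2)]) (use that in auto)
  have X: "X - {t} \<in> locally_finite_sets" for t
    unfolding X_def by (intro locally_finite_sets_Diff N_locally_finite \<omega>)
  have "reduced_campbell W (A \<times> void_event C) \<omega> =
      (\<integral>\<^sup>+t. indicator {t. t \<in> A \<and> (X - {t}) \<inter> C = {}} t \<partial>count_space (X \<inter> W))"
    unfolding reduced_campbell_def X_def[symmetric]
    using X by (intro nn_integral_cong) (simp add: indicator_def void_event_def)
  also have "\<dots> = of_nat (card (X \<inter> W \<inter> {t. t \<in> A \<and> (X - {t}) \<inter> C = {}}))"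
    by (rule nn_integral_indicator_count_space[OF fin(1)])
  finally have red: "reduced_campbell W (A \<times> void_event C) \<omega> =
      of_nat (card (X \<inter> W \<inter> {t. t \<in> A \<and> (X - {t}) \<inter> C = {}}))" .
  consider "X \<inter> C = {}" | a where "X \<inter> C = {a}" | a b where "a \<in> X \<inter> C" "b \<in> X \<inter> C" "a \<noteq> b"
    by blast
  then show ?thesis
  proof cases
    case 1
    then have "X \<inter> W \<inter> {t. t \<in> A \<and> (X - {t}) \<inter> C = {}} = X \<inter> (A \<inter> W - C)" "X \<inter> (A \<inter> W \<inter> C) = {}"
      by blast+
    with 1 show ?thesis
      unfolding red X_def[symmetric] using \<omega>
      by (simp add: indicator_def X_def)
  next
    case (2 a)
    show ?thesis
    proof (cases "a \<in> A \<inter> W")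
      case True
      with 2 have "X \<inter> W \<inter> {t. t \<in> A \<and> (X - {t}) \<inter> C = {}} = {a}"
        "X \<inter> (A \<inter> W \<inter> C) = {a}"
        by blast+
      moreover have "X \<inter> (C - A \<inter> W) = {}"
        using 2 True by (auto simp: set_eq_iff)
      ultimately show ?thesis
        unfolding red X_def[symmetric] using 2 \<omega>
        by (simp add: indicator_def X_def)
    next
      case False
      with 2 have "X \<inter> W \<inter> {t. t \<in> A \<and> (X - {t}) \<inter> C = {}} = {}"
        by blast
      moreover have "X \<inter> (A \<inter> W \<inter> C) = {}"
        using 2 False by (auto simp: set_eq_iff)
      ultimately show ?thesis
        unfolding red X_def[symmetric] using 2 \<omega>
        by (simp add: indicator_def X_def)
    qed
  next
    case (3 a b)
    then have e: "X \<inter> W \<inter> {t. t \<in> A \<and> (X - {t}) \<inter> C = {}} = {}" "X \<inter> C \<noteq> {}"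
      by blast+
    have "\<not> (card (X \<inter> (A \<inter> W \<inter> C)) = 1 \<and> card (X \<inter> (C - A \<inter> W)) = 0)"
    proof
      assume "card (X \<inter> (A \<inter> W \<inter> C)) = 1 \<and> card (X \<inter> (C - A \<inter> W)) = 0"
      then have "X \<inter> (C - A \<inter> W) = {}" "\<exists>c. X \<inter> (A \<inter> W \<inter> C) = {c}"
        unfolding card_0_eq[OF sub[OF Diff_subset]] by (auto simp: card_1_singleton_iff)
      moreover have "X \<inter> C = X \<inter> (C - A \<inter> W) \<union> X \<inter> (A \<inter> W \<inter> C)"
        by blast
      ultimately show False
        using 3 by (metis Un_empty_left singletonD)
    qed
    with e show ?thesis
      unfolding red X_def[symmetric] using \<omega>
      by (simp add: indicator_def X_def)
  qed
qed

definition mecke_holds :: "'a set \<Rightarrow> ('a \<times> 'a set) set \<Rightarrow> bool" where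
  "mecke_holds W S \<longleftrightarrow> reduced_campbell W S \<in> borel_measurable M \<and>
     (\<integral>\<^sup>+\<omega>. reduced_campbell W S \<omega> \<partial>M) = emeasure (mecke_measure W) S"

lemma mecke_holds_void:
  assumes W: "W \<in> sets borel" "bounded W" and A: "A \<in> sets borel"
    and C: "C \<in> sets borel" "bounded C"
  shows "mecke_holds W (A \<times> void_event C)"
proof -
  let ?V = "A \<inter> W"
  let ?f = "\<lambda>\<omega>. indicator {\<omega>\<in>space M. N \<omega> \<inter> C = {}} \<omega> * of_nat (card (N \<omega> \<inter> (?V - C))) :: ennreal"
  let ?E = "{\<omega>\<in>space M. card (N \<omega> \<inter> (?V \<inter> C)) = 1 \<and> card (N \<omega> \<inter> (C - ?V)) = 0}"
  have V: "?V \<in> sets borel" "bounded ?V" "?V - C \<in> sets borel" "bounded (?V - C)"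
    "?V \<inter> C \<in> sets borel" "bounded (?V \<inter> C)" "C - ?V \<in> sets borel" "bounded (C - ?V)"
    using W A C by (auto simp: bounded_Int bounded_diff)
  have f: "?f \<in> borel_measurable M"
    using measurable_card_N[OF V(3,4)] sets_void_N[OF C(1)] by measurable
  have E: "?E \<in> events"
    using sets.Int[OF sets_card_N[OF V(5,6), of 1] sets_card_N[OF V(7,8), of 0]]
    by (simp add: Int_def conj_ac cong: conj_cong)
  have "reduced_campbell W (A \<times> void_event C) \<in> borel_measurable M"
    using f E by (subst measurable_cong[OF reduced_campbell_void_pointwise[OF W(2) C(2)]]) auto
  moreover have "(\<integral>\<^sup>+\<omega>. reduced_campbell W (A \<times> void_event C) \<omega> \<partial>M) =
      ennreal (lam * measure lborel ?V * exp (- (lam * measure lborel C)))"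
  proof -
    let ?m = "measure lborel"
    have "(\<integral>\<^sup>+\<omega>. reduced_campbell W (A \<times> void_event C) \<omega> \<partial>M) =
        (\<integral>\<^sup>+\<omega>. ?f \<omega> + indicator ?E \<omega> \<partial>M)"
      by (rule nn_integral_cong) (rule reduced_campbell_void_pointwise[OF W(2) C(2)])
    also have "\<dots> = (\<integral>\<^sup>+\<omega>. ?f \<omega> \<partial>M) + emeasure M ?E"
      using f E by (subst nn_integral_add) auto
    also have "(\<integral>\<^sup>+\<omega>. ?f \<omega> \<partial>M) = ennreal (exp (- (lam * ?m C)) * (lam * ?m (?V - C)))"
      using V C by (intro mean_card_void) auto
    also have "prob ?E = lam * ?m (?V \<inter> C) * exp (- (lam * ?m (?V \<inter> C))) * exp (- (lam * ?m (C - ?V)))"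
      using V by (subst prob_card_N_disjoint) (auto simp: prob_card_N)
    then have "emeasure M ?E = ennreal (lam * ?m (?V \<inter> C) * exp (- (lam * ?m C)))"
      unfolding emeasure_eq_measure measure_lborel_split[OF C V(1)]
      by (simp add: Int_commute exp_add[symmetric] algebra_simps)
    also have "ennreal (exp (- (lam * ?m C)) * (lam * ?m (?V - C))) +
        ennreal (lam * ?m (?V \<inter> C) * exp (- (lam * ?m C))) =
        ennreal (lam * ?m ?V * exp (- (lam * ?m C)))"
      unfolding measure_lborel_split[OF V(1,2) C(1)] using lam_pos
      by (subst ennreal_plus[symmetric]) (auto simp: algebra_simps)
    finally show ?thesis .
  qed
  moreover have "emeasure (mecke_measure W) (A \<times> void_event C) =
      ennreal (lam * measure lborel ?V * exp (- (lam * measure lborel C)))"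
  proof -
    have "N -` void_event C \<inter> space M = {\<omega>\<in>space M. N \<omega> \<inter> C = {}}"
      using N_locally_finite by (auto simp: void_event_def)
    moreover have "emeasure lborel ?V = ennreal (measure lborel ?V)"
      using emeasure_bounded_finite[OF V(2)] by (simp add: emeasure_eq_ennreal_measure)
    ultimately show ?thesis
      using emeasure_mecke_Times[OF W(1) A void_event_sets[OF C]] lam_pos prob_void_bounded[OF C]
      by (simp add: emeasure_eq_measure ennreal_mult'[symmetric] Int_commute)
  qed
  ultimately show ?thesis
    by (simp add: mecke_holds_def)
qed

lemma mecke_holds_Diff:
  assumes W: "W \<in> sets borel" "bounded W" and S: "mecke_holds W S" "mecke_holds W S'"
    and sub: "S' \<subseteq> S" "S \<in> sets (borel \<Otimes>\<^sub>M configs)" "S' \<in> sets (borel \<Otimes>\<^sub>M configs)"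
  shows "mecke_holds W (S - S')"
proof -
  have fin: "reduced_campbell W S' \<omega> < \<infinity>" if "\<omega> \<in> space M" for \<omega>
  proof -
    have "reduced_campbell W S' \<omega> \<le> (\<integral>\<^sup>+t. 1 \<partial>count_space (N \<omega> \<inter> W))"
      unfolding reduced_campbell_def by (intro nn_integral_mono) (simp add: indicator_def)
    also have "\<dots> < \<infinity>"
      using finite_N[OF that W(2)] by (simp add: nn_integral_count_space_finite of_nat_less_top)
    finally show ?thesis .
  qed
  have le: "reduced_campbell W S' \<omega> \<le> reduced_campbell W S \<omega>" for \<omega>
    unfolding reduced_campbell_def using sub(1)
    by (intro nn_integral_mono) (auto simp: indicator_def)
  have eq: "reduced_campbell W (S - S') \<omega> = reduced_campbell W S \<omega> - reduced_campbell W S' \<omega>"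
    if "\<omega> \<in> space M" for \<omega>
  proof -
    have "reduced_campbell W (S - S') \<omega> =
      (\<integral>\<^sup>+t. indicator S (t, N \<omega> - {t}) - indicator S' (t, N \<omega> - {t}) \<partial>count_space (N \<omega> \<inter> W))"
      unfolding reduced_campbell_def using sub(1)
      by (intro nn_integral_cong) (auto simp: indicator_def)
    also have "\<dots> = reduced_campbell W S \<omega> - reduced_campbell W S' \<omega>"
      unfolding reduced_campbell_def using fin[OF that] sub(1)
      by (intro nn_integral_diff) (auto simp: reduced_campbell_def indicator_def)
    finally show ?thesis .
  qed
  have m: "reduced_campbell W S \<in> borel_measurable M" "reduced_campbell W S' \<in> borel_measurable M"
    using S by (auto simp: mecke_holds_def)
  have "reduced_campbell W (S - S') \<in> borel_measurable M"
    using m by (subst measurable_cong[OF eq]) auto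
  moreover have "(\<integral>\<^sup>+\<omega>. reduced_campbell W (S - S') \<omega> \<partial>M) =
      (\<integral>\<^sup>+\<omega>. reduced_campbell W S \<omega> - reduced_campbell W S' \<omega> \<partial>M)"
    by (intro nn_integral_cong eq)
  moreover have "\<dots> = emeasure (mecke_measure W) S - emeasure (mecke_measure W) S'"
    using m le S emeasure_mecke_finite[OF W, of S']
    by (subst nn_integral_diff) (auto simp: mecke_holds_def)
  moreover have "\<dots> = emeasure (mecke_measure W) (S - S')"
    using sub emeasure_mecke_finite[OF W, of S'] by (intro emeasure_Diff[symmetric]) auto
  ultimately show ?thesis
    by (simp add: mecke_holds_def)
qed

lemma mecke_holds_UN:
  fixes A :: "nat \<Rightarrow> ('a \<times> 'a set) set"
  assumes A: "\<And>i. mecke_holds W (A i)" "disjoint_family A"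
    "\<And>i. A i \<in> sets (borel \<Otimes>\<^sub>M configs)"
  shows "mecke_holds W (\<Union>i. A i)"
proof -
  have eq: "reduced_campbell W (\<Union>i. A i) = (\<lambda>\<omega>. \<Sum>i. reduced_campbell W (A i) \<omega>)"
    unfolding reduced_campbell_def
    by (intro ext, subst nn_integral_suminf[symmetric])
      (auto intro!: nn_integral_cong simp: suminf_indicator[OF A(2)])
  have m: "reduced_campbell W (A i) \<in> borel_measurable M" for i
    using A(1) by (simp add: mecke_holds_def)
  have "(\<integral>\<^sup>+\<omega>. (\<Sum>i. reduced_campbell W (A i) \<omega>) \<partial>M) = (\<Sum>i. emeasure (mecke_measure W) (A i))"
    using m A(1) by (subst nn_integral_suminf) (auto simp: mecke_holds_def)
  also have "\<dots> = emeasure (mecke_measure W) (\<Union>i. A i)"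
    using A(2,3) by (intro suminf_emeasure) auto
  finally show ?thesis
    using m by (simp add: mecke_holds_def eq)
qed

lemma mecke_holds_empty: "mecke_holds W {}"
proof -
  have "reduced_campbell W {} = (\<lambda>_. 0)"
    by (simp add: fun_eq_iff reduced_campbell_def)
  then show ?thesis
    by (simp add: mecke_holds_def)
qed

lemma mecke_holds_Times:
  assumes W: "W \<in> sets borel" "bounded W" and A: "A \<in> sets borel" and V: "V \<in> sets configs"
  shows "mecke_holds W (A \<times> V)"
  using Int_stable_void void_generator_closed V
  unfolding sets_configs
proof (induct rule: sigma_sets_induct_disjoint)
  case (basic V)
  then show ?case using mecke_holds_void[OF W A] by auto
next
  case empty
  show ?case using mecke_holds_empty by simp
next
  case (compl V)
  have "void_event {} = (locally_finite_sets :: 'a set set)"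
    by (simp add: void_event_def)
  then have top: "mecke_holds W (A \<times> locally_finite_sets)"
    using mecke_holds_void[OF W A, of "{}"] by simp
  have V: "V \<in> sets configs" "locally_finite_sets \<in> sets configs"
    using compl(1) sets.top[of configs] by (simp_all add: sets_configs)
  then have "A \<times> V \<subseteq> A \<times> locally_finite_sets"
    using sets.sets_into_space[OF V(1)] by auto
  then have "mecke_holds W (A \<times> locally_finite_sets - A \<times> V)"
    using V A by (intro mecke_holds_Diff[OF W top compl(2)]) auto
  moreover have "A \<times> locally_finite_sets - A \<times> V = A \<times> (locally_finite_sets - V)"
    by blast
  ultimately show ?case by simp
next
  case (union F)
  have "mecke_holds W (\<Union>i. A \<times> F i)"
  proof (rule mecke_holds_UN[OF union(3)])
    show "disjoint_family (\<lambda>i. A \<times> F i)"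
      using union(1) by (auto simp: disjoint_family_on_def)
    show "A \<times> F i \<in> sets (borel \<Otimes>\<^sub>M configs)" for i
    proof -
      have "F i \<in> sets configs"
        using union(2) unfolding sets_configs by blast
      then show ?thesis using A by simp
    qed
  qed
  moreover have "(\<Union>i. A \<times> F i) = A \<times> (\<Union>i. F i)"
    by blast
  ultimately show ?case by simp
qed

theorem mecke:
  assumes W: "W \<in> sets borel" "bounded W" and S: "S \<in> sets (borel \<Otimes>\<^sub>M configs)"
  shows "mecke_holds W S"
  using Int_stable_pair_measure_generator pair_measure_closed S
  unfolding sets_pair_measure[where A = "borel::'a measure" and B = "configs::'a set measure"]
proof (induct rule: sigma_sets_induct_disjoint)
  case (basic S)
  then show ?case using mecke_holds_Times[OF W] by auto
next
  case empty
  show ?case by (rule mecke_holds_empty)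
next
  case (compl S)
  have S: "S \<in> sets (borel \<Otimes>\<^sub>M configs)"
    using compl(1) by (simp add: sets_pair_measure)
  have top: "space borel \<times> space configs \<in> sets (borel \<Otimes>\<^sub>M configs :: ('a \<times> 'a set) measure)"
    by (intro pair_measureI sets.top)
  show ?case
    using sets.sets_into_space[OF S] top S
    by (intro mecke_holds_Diff[OF W mecke_holds_Times[OF W sets.top sets.top] compl(2)])
      (simp_all only: space_pair_measure)
next
  case (union F)
  then show ?case
    by (intro mecke_holds_UN) (auto simp: sets_pair_measure)
qed

end

definition void_shift :: "'a::euclidean_space set \<Rightarrow> ('a \<times> 'a set) set" where
  "void_shift B = {(t, \<phi>). \<phi> \<in> locally_finite_sets \<and> (\<forall>s\<in>\<phi>. s - t \<notin> B)}"

lemma sets_void_shift: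
  fixes B :: "'a::euclidean_space set"
  assumes "B \<in> sets borel"
  shows "void_shift B \<in> sets (borel \<Otimes>\<^sub>M configs)"
proof -
  have "(\<lambda>(t::'a, s). s - t) -` B \<inter> space (borel \<Otimes>\<^sub>M borel) \<in> sets (borel \<Otimes>\<^sub>M borel)"
    by (rule measurable_sets[OF _ assms]) measurable
  from sets_void_section[OF this] show ?thesis
    by (simp add: void_shift_def space_pair_measure)
qed

context poisson
begin

lemma emeasure_mecke_void_shift:
  assumes W: "W \<in> sets borel" "bounded W" and B: "B \<in> sets borel" "emeasure lborel B < \<infinity>"
  shows "emeasure (mecke_measure W) (void_shift B) =
    ennreal (lam * measure lborel W * exp (- (lam * measure lborel B)))"
proof -
  interpret D: prob_space "distr M configs N"
    by (rule prob_space_distr_N)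
  let ?\<nu> = "density lborel (\<lambda>t. ennreal lam * indicator W t)"
  have "emeasure (distr M configs N) (Pair t -` void_shift B) =
      ennreal (exp (- (lam * measure lborel B)))" for t
  proof -
    let ?C = "{s. s - t \<in> B}"
    have S: "Pair t -` void_shift B \<in> sets configs"
      by (rule sets_Pair1[OF sets_void_shift[OF B(1)]])
    have "N -` (Pair t -` void_shift B) \<inter> space M = {\<omega>\<in>space M. N \<omega> \<inter> ?C = {}}"
      using N_locally_finite by (auto simp: void_shift_def)
    then have "emeasure (distr M configs N) (Pair t -` void_shift B) =
        emeasure M {\<omega>\<in>space M. N \<omega> \<inter> ?C = {}}"
      using emeasure_distr[OF measurable_N S] by simp
    also have "\<dots> = ennreal (exp (- (lam * measure lborel ?C)))"
      unfolding emeasure_eq_measure using emeasure_lborel_vimage_diff[OF B(1)] B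
      by (subst prob_void) (auto intro: sets_vimage_diff)
    also have "measure lborel ?C = measure lborel B"
      using emeasure_lborel_vimage_diff[OF B(1)] by (simp add: measure_def)
    finally show ?thesis .
  qed
  then have "emeasure (mecke_measure W) (void_shift B) =
      (\<integral>\<^sup>+t. ennreal (exp (- (lam * measure lborel B))) \<partial>?\<nu>)"
    unfolding mecke_measure_def using sets_void_shift[OF B(1)]
    by (subst D.emeasure_pair_measure_alt) auto
  also have "\<dots> = ennreal (exp (- (lam * measure lborel B))) * emeasure ?\<nu> UNIV"
    by simp
  also have "emeasure ?\<nu> UNIV = ennreal lam * emeasure lborel W"
    using W by (subst emeasure_density) (auto simp: nn_integral_cmult)
  also have "emeasure lborel W = ennreal (measure lborel W)"
    using emeasure_bounded_finite[OF W(2)] by (simp add: emeasure_eq_ennreal_measure)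
  finally show ?thesis
    using lam_pos by (simp add: ennreal_mult'[symmetric] mult_ac)
qed

lemma campbell_void_shift:
  assumes "W \<in> sets borel" "bounded W" "B \<in> sets borel" "emeasure lborel B < \<infinity>"
  shows "(\<integral>\<^sup>+\<omega>. reduced_campbell W (void_shift B) \<omega> \<partial>M) =
    ennreal (lam * measure lborel W * exp (- (lam * measure lborel B)))"
  using mecke[OF assms(1,2) sets_void_shift[OF assms(3)]] emeasure_mecke_void_shift[OF assms]
  by (simp add: mecke_holds_def)

lemma campbell_void_shift_hit:
  assumes W: "W \<in> sets borel" "bounded W"
    and B: "B \<in> sets borel" "emeasure lborel B < \<infinity>"
    and A: "A \<in> sets borel" "emeasure lborel A < \<infinity>" "A \<inter> B = {}"
  shows "(\<integral>\<^sup>+\<omega>. reduced_campbell W (void_shift B - void_shift (A \<union> B)) \<omega> \<partial>M) \<le>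
    ennreal (lam * measure lborel W * exp (- (lam * measure lborel B))) *
      min 1 (ennreal lam * emeasure lborel A)"
proof -
  let ?m = "measure lborel"
  have AB: "A \<union> B \<in> sets borel" "emeasure lborel (A \<union> B) < \<infinity>"
    using A B emeasure_subadditive[of A lborel B] by (auto simp: less_top[symmetric] top_unique)
  have mAB: "?m (A \<union> B) = ?m A + ?m B"
    using A B by (intro measure_Union) auto
  have "(\<integral>\<^sup>+\<omega>. reduced_campbell W (void_shift B - void_shift (A \<union> B)) \<omega> \<partial>M) =
      emeasure (mecke_measure W) (void_shift B - void_shift (A \<union> B))"
    using mecke[OF W, of "void_shift B - void_shift (A \<union> B)"] sets_void_shift[OF B(1)]
      sets_void_shift[OF AB(1)] by (simp add: mecke_holds_def)
  also have "\<dots> = emeasure (mecke_measure W) (void_shift B) -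
      emeasure (mecke_measure W) (void_shift (A \<union> B))"
    using sets_void_shift[OF B(1)] sets_void_shift[OF AB(1)]
      emeasure_mecke_finite[OF W, of "void_shift (A \<union> B)"]
    by (intro emeasure_Diff) (auto simp: void_shift_def)
  also have "\<dots> = ennreal (lam * ?m W * exp (- (lam * ?m B)) * (1 - exp (- (lam * ?m A))))"
    unfolding emeasure_mecke_void_shift[OF W B] emeasure_mecke_void_shift[OF W AB] mAB
    using lam_pos by (subst ennreal_minus) (auto simp: algebra_simps exp_add[symmetric])
  also have "\<dots> \<le> ennreal (lam * ?m W * exp (- (lam * ?m B)) * min 1 (lam * ?m A))"
    using lam_pos exp_ge_add_one_self[of "- (lam * ?m A)"]
    by (intro ennreal_leI mult_left_mono) auto
  also have "\<dots> = ennreal (lam * ?m W * exp (- (lam * ?m B))) * min 1 (ennreal lam * emeasure lborel A)"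
  proof -
    have "emeasure lborel A = ennreal (?m A)"
      using A(2) by (simp add: emeasure_eq_ennreal_measure)
    then have "ennreal lam * emeasure lborel A = ennreal (lam * ?m A)"
      using lam_pos by (simp add: ennreal_mult'[symmetric])
    then have "min 1 (ennreal lam * emeasure lborel A) = ennreal (min 1 (lam * ?m A))"
      using lam_pos min_ennreal[of 1 "lam * ?m A"] by simp
    then show ?thesis
      using lam_pos by (simp add: ennreal_mult)
  qed
  finally show ?thesis .
qed

end

section \<open>Decoding errors of the Matern process\<close>

lemma nn_integral_count_space_le:
  assumes "\<And>t. g t * indicator A t \<le> h t * indicator B t"
  shows "(\<integral>\<^sup>+t. g t \<partial>count_space A) \<le> (\<integral>\<^sup>+t. h t \<partial>count_space B)"
proof -
  have *: "(\<integral>\<^sup>+t. f t \<partial>count_space C) = (\<integral>\<^sup>+t. f t * indicator C t \<partial>count_space UNIV)"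
    for f :: "'a \<Rightarrow> ennreal" and C
    by (simp add: nn_integral_restrict_space[symmetric] restrict_count_space)
  show ?thesis
    unfolding *[where f = g] *[where f = h] using assms by (intro nn_integral_mono) auto
qed

lemma DD_less_iff:
  fixes f :: "real ^ 'n \<Rightarrow> real"
  assumes "0 \<le> f (x - y)" "0 < a"
  shows "DD f x y < ereal (- (1 / real CARD('n)) * ln a) \<longleftrightarrow> a < f (x - y)"
  using assms by (auto simp: DD_def divide_less_cancel)

lemma tendsto_one_minus_inverse: "(\<lambda>m. 1 - 1 / real (m + 2)) \<longlonglongrightarrow> 1"
  by real_asymp

locale matern_channel = poisson M lam N
  for M :: "'w measure" and lam :: real and N :: "'w \<Rightarrow> (real ^ 'n) set" +
  fixes f :: "real ^ 'n \<Rightarrow> real" and \<xi> :: real and T D :: "nat \<Rightarrow> 'w \<Rightarrow> real ^ 'n"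
  assumes f_nonneg: "0 \<le> f x" and f_even: "f (- x) = f x"
    and f_measurable [measurable]: "f \<in> borel_measurable borel"
    and f_integral: "(\<integral>\<^sup>+x. ennreal (f x) \<partial>lborel) = 1"
    and marking: "iid_marking M (\<lambda>\<omega>. matern f \<xi> (N \<omega>)) (density lborel (\<lambda>x. ennreal (f x))) T D"
begin

definition core :: "(real ^ 'n) set" where
  "core = {y. exp (- (real CARD('n) * \<xi>)) < f y}"

definition cube :: "(real ^ 'n) set" where
  "cube = cbox 0 One"

definition rivals :: "nat \<Rightarrow> real ^ 'n \<Rightarrow> (real ^ 'n) set" where
  "rivals m d = {y. (1 - 1 / real (m + 2)) * f d < f (d - y)} - core"

definition ml_rivals :: "real ^ 'n \<Rightarrow> (real ^ 'n) set" where
  "ml_rivals d = {y. f d \<le> f (d - y)} - core"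

lemma f_diff_commute: "f (x - y) = f (y - x)"
  using f_even[of "x - y"] by simp

lemma sets_core [measurable]: "core \<in> sets borel"
  unfolding core_def by measurable

lemma emeasure_superlevel_finite:
  assumes "0 < a"
  shows "emeasure lborel {y. a < f y} < \<infinity>"
proof -
  have "ennreal a * emeasure lborel {y. a < f y} = (\<integral>\<^sup>+y. ennreal a * indicator {y. a < f y} y \<partial>lborel)"
    by (subst nn_integral_cmult) auto
  also have "\<dots> \<le> (\<integral>\<^sup>+y. ennreal (f y) \<partial>lborel)"
    by (intro nn_integral_mono) (auto simp: indicator_def intro: ennreal_leI)
  finally have "ennreal a * emeasure lborel {y. a < f y} < \<infinity>"
    unfolding f_integral by (simp add: order_le_less_trans)
  then show ?thesis
    using assms by (auto simp: ennreal_mult_less_top)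
qed

lemma emeasure_core_finite: "emeasure lborel core < \<infinity>"
  unfolding core_def by (rule emeasure_superlevel_finite) simp

lemma DD_less_\<xi>_iff: "DD f t s < ereal \<xi> \<longleftrightarrow> s - t \<in> core"
proof -
  have "ereal \<xi> = ereal (- (1 / real CARD('n)) * ln (exp (- (real CARD('n) * \<xi>))))"
    by simp
  then show ?thesis
    unfolding core_def mem_Collect_eq f_diff_commute[of s t] using DD_less_iff[of f t s] f_nonneg
    by (metis exp_gt_zero)
qed

lemma matern_iff:
  "\<omega> \<in> space M \<Longrightarrow> t \<in> matern f \<xi> (N \<omega>) \<longleftrightarrow> t \<in> N \<omega> \<and> (t, N \<omega> - {t}) \<in> void_shift core"
  using locally_finite_sets_Diff[OF N_locally_finite]
  by (auto simp: matern_def void_shift_def DD_less_\<xi>_iff)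

lemma sets_rivals [measurable]: "rivals m d \<in> sets borel"
  unfolding rivals_def by measurable

lemma emeasure_rivals_finite:
  assumes "0 < f d"
  shows "emeasure lborel (rivals m d) < \<infinity>"
proof -
  let ?a = "(1 - 1 / real (m + 2)) * f d"
  have "emeasure lborel (rivals m d) \<le> emeasure lborel {y. y - d \<in> {z. ?a < f z}}"
    by (intro emeasure_mono sets_vimage_diff) (auto simp: rivals_def f_diff_commute[of d])
  also have "\<dots> = emeasure lborel {z. ?a < f z}"
    by (rule emeasure_lborel_vimage_diff) measurable
  also have "\<dots> < \<infinity>"
    using assms by (intro emeasure_superlevel_finite) simp
  finally show ?thesis .
qed

lemma INT_rivals:
  assumes "0 < f d"
  shows "(\<Inter>m. rivals m d) = ml_rivals d"
proof -
  have "(\<forall>m. (1 - 1 / real (m + 2)) * f d < f (d - y)) \<longleftrightarrow> f d \<le> f (d - y)" for y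
  proof
    assume "\<forall>m. (1 - 1 / real (m + 2)) * f d < f (d - y)"
    moreover have "(\<lambda>m. (1 - 1 / real (m + 2)) * f d) \<longlonglongrightarrow> 1 * f d"
      by (intro tendsto_mult tendsto_const tendsto_one_minus_inverse)
    ultimately show "f d \<le> f (d - y)"
      by (intro LIMSEQ_le_const2[of _ "f d"]) (auto intro: less_imp_le)
  next
    assume le: "f d \<le> f (d - y)"
    have "(1 - 1 / real (m + 2)) * f d < 1 * f d" for m
      using assms by (intro mult_strict_right_mono) auto
    with le show "\<forall>m. (1 - 1 / real (m + 2)) * f d < f (d - y)"
      by (auto intro: less_le_trans)
  qed
  then show ?thesis
    by (auto simp: rivals_def ml_rivals_def)
qed

lemma emeasure_rivals_tendsto:
  assumes "0 < f d"
  shows "(\<lambda>m. emeasure lborel (rivals m d)) \<longlonglongrightarrow> emeasure lborel (ml_rivals d)"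
  unfolding INT_rivals[OF assms, symmetric]
proof (rule Lim_emeasure_decseq)
  show "decseq (\<lambda>m. rivals m d)"
  proof (rule decseq_SucI)
    fix m
    have "(1 - 1 / real (m + 2)) * f d \<le> (1 - 1 / real (Suc m + 2)) * f d"
      using f_nonneg by (intro mult_right_mono diff_left_mono frac_le) auto
    then show "rivals (Suc m) d \<subseteq> rivals m d"
      by (auto simp: rivals_def)
  qed
  show "emeasure lborel (rivals m d) \<noteq> \<infinity>" for m
    using emeasure_rivals_finite[OF assms, of m] by auto
qed (use sets_rivals in auto)

lemma cube: "cube \<in> sets borel" "bounded cube" "measure lborel cube = 1"
  by (simp_all add: cube_def)

definition \<Lambda> :: ennreal where
  "\<Lambda> = ennreal (lam * exp (- (lam * measure lborel core)))"

lemma AE_enumeration: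
  "AE \<omega> in M. inj (\<lambda>k. T k \<omega>) \<and> range (\<lambda>k. T k \<omega>) = matern f \<xi> (N \<omega>)"
  using marking by (simp add: iid_marking_def)

lemma intensity_eq: "intensity M (marked_points T D) = \<Lambda>"
proof -
  have "intensity M (marked_points T D) = (\<integral>\<^sup>+\<omega>. reduced_campbell cube (void_shift core) \<omega> \<partial>M)"
    unfolding intensity_def
  proof (rule nn_integral_cong_AE)
    show "AE \<omega> in M. (\<integral>\<^sup>+(t, d). indicator (cbox 0 One) t \<partial>count_space (marked_points T D \<omega>)) =
      reduced_campbell cube (void_shift core) \<omega>"
      using AE_enumeration AE_space
    proof eventually_elim
      case (elim \<omega>)
      have "bij_betw fst (marked_points T D \<omega>) (matern f \<xi> (N \<omega>))"
        using elim by (auto simp: bij_betw_def marked_points_def inj_on_def image_image)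
      then have "(\<integral>\<^sup>+(t, d). indicator (cbox 0 One) t \<partial>count_space (marked_points T D \<omega>)) =
          (\<integral>\<^sup>+t. indicator cube t \<partial>count_space (matern f \<xi> (N \<omega>)))"
        by (subst nn_integral_bij_count_space[symmetric]) (auto simp: cube_def split_beta')
      also have "\<dots> = reduced_campbell cube (void_shift core) \<omega>"
        unfolding reduced_campbell_def using elim
        by (intro antisym nn_integral_count_space_le) (auto simp: indicator_def matern_iff)
      finally show ?case .
    qed
  qed
  then show ?thesis
    using campbell_void_shift[OF cube(1,2) sets_core emeasure_core_finite] cube(3)
    by (simp add: \<Lambda>_def)
qed

lemma measurable_T [measurable]: "T k \<in> borel_measurable M"
  using marking by (simp add: iid_marking_def)

lemma indep_TD: "indep_var seq_borel (\<lambda>\<omega> k. T k \<omega>) seq_borel (\<lambda>\<omega> k. D k \<omega>)"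
  using marking by (simp add: iid_marking_def)

lemma distr_D: "distr M borel (D k) = density lborel (\<lambda>x. ennreal (f x))"
  using marking by (simp add: iid_marking_def)

lemma nn_integral_marked:
  assumes g: "(\<lambda>(\<tau>, d). g \<tau> d) \<in> borel_measurable (seq_borel \<Otimes>\<^sub>M borel)"
  shows "(\<integral>\<^sup>+\<omega>. g (\<lambda>j. T j \<omega>) (D k \<omega>) \<partial>M) =
    (\<integral>\<^sup>+d. (\<integral>\<^sup>+\<omega>. g (\<lambda>j. T j \<omega>) d \<partial>M) * ennreal (f d) \<partial>lborel)"
proof -
  let ?S = "seq_borel :: (nat \<Rightarrow> real ^ 'n) measure"
  let ?T = "\<lambda>\<omega> j. T j \<omega>" and ?D = "\<lambda>\<omega> j. D j \<omega>"
  let ?H = "\<lambda>d. \<integral>\<^sup>+\<omega>. g (?T \<omega>) d \<partial>M"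
  have T: "?T \<in> measurable M ?S" and D: "?D \<in> measurable M ?S"
    using indep_TD by (rule indep_var_rv1, rule indep_var_rv2)
  have Dk: "D k \<in> borel_measurable M"
    using measurable_compose[OF D measurable_component_singleton[of k UNIV]] by simp
  interpret PT: prob_space "distr M ?S ?T"
    by (rule prob_space_distr[OF T])
  interpret PD: prob_space "distr M ?S ?D"
    by (rule prob_space_distr[OF D])
  interpret TD: pair_sigma_finite "distr M ?S ?T" "distr M ?S ?D" ..
  have G: "(\<lambda>(\<tau>, \<delta>). g \<tau> (\<delta> k)) \<in> borel_measurable (?S \<Otimes>\<^sub>M ?S)"
    using measurable_Pair_compose_split[OF g measurable_fst
        measurable_compose[OF measurable_snd measurable_component_singleton[of k UNIV]]]
    by (simp add: split_beta')
  then have G': "(\<lambda>(\<tau>, \<delta>). g \<tau> (\<delta> k)) \<in> borel_measurable (distr M ?S ?T \<Otimes>\<^sub>M distr M ?S ?D)"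
    by (simp cong: measurable_cong_sets)
  have gd: "(\<lambda>\<tau>. g \<tau> d) \<in> borel_measurable ?S" for d
    using measurable_Pair_compose_split[OF g measurable_ident measurable_const, of d] by simp
  have H: "?H \<in> borel_measurable borel"
  proof -
    have "(\<lambda>(d, \<tau>). g \<tau> d) \<in> borel_measurable (borel \<Otimes>\<^sub>M distr M ?S ?T)"
      using measurable_pair_swap[OF g] by (simp add: split_beta' cong: measurable_cong_sets)
    then have "(\<lambda>d. \<integral>\<^sup>+\<tau>. g \<tau> d \<partial>distr M ?S ?T) \<in> borel_measurable borel"
      by (rule PT.borel_measurable_nn_integral)
    then show ?thesis
      using T gd by (simp add: nn_integral_distr)
  qed
  have "(\<integral>\<^sup>+\<omega>. g (?T \<omega>) (D k \<omega>) \<partial>M) =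
      (\<integral>\<^sup>+x. (\<lambda>(\<tau>, \<delta>). g \<tau> (\<delta> k)) x \<partial>distr M (?S \<Otimes>\<^sub>M ?S) (\<lambda>\<omega>. (?T \<omega>, ?D \<omega>)))"
    using G T D by (subst nn_integral_distr) auto
  also have "distr M (?S \<Otimes>\<^sub>M ?S) (\<lambda>\<omega>. (?T \<omega>, ?D \<omega>)) = distr M ?S ?T \<Otimes>\<^sub>M distr M ?S ?D"
    using indep_TD by (simp add: indep_var_distribution_eq)
  also have "(\<integral>\<^sup>+x. (\<lambda>(\<tau>, \<delta>). g \<tau> (\<delta> k)) x \<partial>(distr M ?S ?T \<Otimes>\<^sub>M distr M ?S ?D)) =
      (\<integral>\<^sup>+\<delta>. \<integral>\<^sup>+\<tau>. g \<tau> (\<delta> k) \<partial>distr M ?S ?T \<partial>distr M ?S ?D)"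
    using TD.nn_integral_snd[OF G'] by simp
  also have "\<dots> = (\<integral>\<^sup>+\<delta>. ?H (\<delta> k) \<partial>distr M ?S ?D)"
    using T gd by (simp add: nn_integral_distr)
  also have "\<dots> = (\<integral>\<^sup>+\<omega>. ?H (D k \<omega>) \<partial>M)"
    using D measurable_compose[OF measurable_component_singleton[of k UNIV] H]
    by (subst nn_integral_distr) auto
  also have "\<dots> = (\<integral>\<^sup>+d. ?H d \<partial>distr M borel (D k))"
    using Dk H by (simp add: nn_integral_distr)
  also have "\<dots> = (\<integral>\<^sup>+d. ?H d * ennreal (f d) \<partial>lborel)"
    unfolding distr_D using H by (subst nn_integral_density) (auto simp: mult.commute)
  finally show ?thesis .
qed

definition confused :: "nat \<Rightarrow> (nat \<Rightarrow> real ^ 'n) \<Rightarrow> real ^ 'n \<Rightarrow> bool" where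
  "confused k \<tau> d \<longleftrightarrow> \<tau> k \<in> cube \<and> (\<forall>m. \<exists>j. \<tau> j \<noteq> \<tau> k \<and> \<tau> j - \<tau> k \<in> rivals m d)"

lemma measurable_confused [measurable]:
  "(\<lambda>(\<tau>, d). of_bool (confused k \<tau> d) :: ennreal) \<in> borel_measurable (seq_borel \<Otimes>\<^sub>M borel)"
proof -
  note [measurable] = cube(1)
  have "Measurable.pred (seq_borel \<Otimes>\<^sub>M borel) (\<lambda>x. fst x k \<in> cube \<and>
      (\<forall>m. \<exists>j. 0 < norm (fst x j - fst x k) \<and>
        (1 - 1 / real (m + 2)) * f (snd x) < f (snd x - (fst x j - fst x k)) \<and>
        \<not> exp (- (real CARD('n) * \<xi>)) < f (fst x j - fst x k)))"
    by measurable
  then have [measurable]: "Measurable.pred (seq_borel \<Otimes>\<^sub>M borel) (\<lambda>x. confused k (fst x) (snd x))"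
    by (simp add: confused_def rivals_def core_def)
  show ?thesis
    unfolding split_beta' of_bool_def by measurable
qed

lemma error_imp_confused:
  assumes \<omega>: "\<omega> \<in> space M" "inj (\<lambda>k. T k \<omega>)" "range (\<lambda>k. T k \<omega>) = matern f \<xi> (N \<omega>)"
    and pos: "0 < f (D k \<omega>)" and cube: "T k \<omega> \<in> cube"
    and d: "(0, d) \<in> recentre (T k \<omega>) (marked_points T D \<omega>)"
      "d \<notin> decoding_region f (fst ` recentre (T k \<omega>) (marked_points T D \<omega>)) 0"
  shows "confused k (\<lambda>j. T j \<omega>) (D k \<omega>)"
proof -
  obtain j where "T j \<omega> - T k \<omega> = 0" "d = D j \<omega>"
    using d(1) by (auto simp: recentre_def marked_points_def)
  then have dk: "d = D k \<omega>"
    using \<omega>(2) by (auto dest: injD)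
  have pts: "fst ` recentre (T k \<omega>) (marked_points T D \<omega>) = range (\<lambda>j. T j \<omega> - T k \<omega>)"
    by (auto simp: recentre_def marked_points_def image_image)
  have inf: "(INF s\<in>range (\<lambda>j. T j \<omega> - T k \<omega>) - {0}. DD f d s) \<le> DD f d 0"
    using d(2) unfolding pts by (auto simp: decoding_region_def strict_ml_def not_less)
  have "\<exists>j. T j \<omega> \<noteq> T k \<omega> \<and> T j \<omega> - T k \<omega> \<in> rivals m (D k \<omega>)" for m
  proof -
    let ?a = "(1 - 1 / real (m + 2)) * f d"
    have a: "0 < ?a" "?a < 1 * f d"
      using pos dk by (auto intro!: mult_strict_right_mono mult_pos_pos)
    note inf
    also have "DD f d 0 < ereal (- (1 / real CARD('n)) * ln ?a)"
      using a DD_less_iff[of f d 0 ?a] f_nonneg by simp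
    finally obtain s where s: "s \<in> range (\<lambda>j. T j \<omega> - T k \<omega>) - {0}"
      "DD f d s < ereal (- (1 / real CARD('n)) * ln ?a)"
      unfolding INF_less_iff by blast
    then obtain j where j: "T j \<omega> - T k \<omega> \<noteq> 0"
      "DD f d (T j \<omega> - T k \<omega>) < ereal (- (1 / real CARD('n)) * ln ?a)"
      by blast
    then have "?a < f (d - (T j \<omega> - T k \<omega>))"
      using a(1) DD_less_iff f_nonneg by blast
    moreover have "T j \<omega> - T k \<omega> \<notin> core"
    proof -
      have "T j \<omega> \<in> matern f \<xi> (N \<omega>)" "T k \<omega> \<in> matern f \<xi> (N \<omega>)"
        using \<omega>(3) by auto
      then show ?thesis
        using j(1) by (auto simp: matern_def DD_less_\<xi>_iff)
    qed
    ultimately show ?thesis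
      using j(1) dk by (auto simp: rivals_def)
  qed
  with cube show ?thesis
    by (auto simp: confused_def)
qed

lemma expected_confused_le_rivals:
  assumes d: "0 < f d"
  shows "(\<integral>\<^sup>+\<omega>. (\<Sum>k. of_bool (confused k (\<lambda>j. T j \<omega>) d)) \<partial>M) \<le>
    \<Lambda> * min 1 (ennreal lam * emeasure lborel (rivals m d))"
proof -
  let ?S = "void_shift core - void_shift (rivals m d \<union> core)"
  have "(\<integral>\<^sup>+\<omega>. (\<Sum>k. of_bool (confused k (\<lambda>j. T j \<omega>) d)) \<partial>M) \<le>
      (\<integral>\<^sup>+\<omega>. reduced_campbell cube ?S \<omega> \<partial>M)"
  proof (rule nn_integral_mono_AE)
    show "AE \<omega> in M. (\<Sum>k. of_bool (confused k (\<lambda>j. T j \<omega>) d)) \<le> reduced_campbell cube ?S \<omega>"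
      using AE_enumeration AE_space
    proof eventually_elim
      case (elim \<omega>)
      then have \<omega>: "inj (\<lambda>k. T k \<omega>)" "range (\<lambda>k. T k \<omega>) = matern f \<xi> (N \<omega>)" "\<omega> \<in> space M"
        by auto
      let ?P = "\<lambda>t. t \<in> cube \<and> (\<exists>s\<in>matern f \<xi> (N \<omega>). s \<noteq> t \<and> s - t \<in> rivals m d)"
      have "(\<Sum>k. of_bool (confused k (\<lambda>j. T j \<omega>) d) :: ennreal) =
          (\<integral>\<^sup>+k. of_bool (confused k (\<lambda>j. T j \<omega>) d) \<partial>count_space UNIV)"
        by (simp add: nn_integral_count_space_nat)
      also have "\<dots> \<le> (\<integral>\<^sup>+k. of_bool (?P (T k \<omega>)) \<partial>count_space UNIV)"
        unfolding \<omega>(2)[symmetric] by (intro nn_integral_mono) (auto simp: confused_def)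
      also have "\<dots> = (\<integral>\<^sup>+t. of_bool (?P t) \<partial>count_space (matern f \<xi> (N \<omega>)))"
        using \<omega>(1,2) by (intro nn_integral_bij_count_space) (auto simp: bij_betw_def)
      also have "\<dots> \<le> reduced_campbell cube ?S \<omega>"
        unfolding reduced_campbell_def
      proof (rule nn_integral_count_space_le)
        fix t
        have imp: "t \<in> N \<omega> \<inter> cube \<and> (t, N \<omega> - {t}) \<in> ?S" if t: "t \<in> matern f \<xi> (N \<omega>)" "?P t"
        proof -
          obtain s where "s \<in> N \<omega>" "s \<noteq> t" "s - t \<in> rivals m d"
            using t(2) by (auto simp: matern_def)
          then have "(t, N \<omega> - {t}) \<notin> void_shift (rivals m d \<union> core)"
            by (auto simp: void_shift_def)
          then show ?thesis
            using t matern_iff[OF \<omega>(3)] by auto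
        qed
        show "of_bool (?P t) * indicator (matern f \<xi> (N \<omega>)) t \<le>
            (indicator ?S (t, N \<omega> - {t}) * indicator (N \<omega> \<inter> cube) t :: ennreal)"
        proof (cases "t \<in> matern f \<xi> (N \<omega>) \<and> ?P t")
          case True
          then show ?thesis
            using imp by (simp add: indicator_def)
        qed (auto simp: indicator_def)
      qed
      finally show ?case .
    qed
  qed
  also have "\<dots> \<le> \<Lambda> * min 1 (ennreal lam * emeasure lborel (rivals m d))"
    using campbell_void_shift_hit[OF cube(1,2) sets_core emeasure_core_finite sets_rivals
        emeasure_rivals_finite[OF d]] cube(3)
    by (auto simp: \<Lambda>_def rivals_def)
  finally show ?thesis .
qed

lemma expected_confused_le:
  assumes d: "0 < f d"
  shows "(\<integral>\<^sup>+\<omega>. (\<Sum>k. of_bool (confused k (\<lambda>j. T j \<omega>) d)) \<partial>M) \<le>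
    \<Lambda> * min 1 (ennreal lam * emeasure lborel (ml_rivals d))"
proof (rule LIMSEQ_le_const)
  show "(\<lambda>m. \<Lambda> * min 1 (ennreal lam * emeasure lborel (rivals m d)))
      \<longlonglongrightarrow> \<Lambda> * min 1 (ennreal lam * emeasure lborel (ml_rivals d))"
    using emeasure_rivals_tendsto[OF d]
    by (intro ennreal_tendsto_cmult tendsto_min tendsto_const) (auto simp: \<Lambda>_def)
  show "\<exists>K. \<forall>m\<ge>K. (\<integral>\<^sup>+\<omega>. (\<Sum>k. of_bool (confused k (\<lambda>j. T j \<omega>) d)) \<partial>M) \<le>
      \<Lambda> * min 1 (ennreal lam * emeasure lborel (rivals m d))"
    using expected_confused_le_rivals[OF d] by blast
qed

lemma AE_density_pos: "AE \<omega> in M. \<forall>k. 0 < f (D k \<omega>)"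
  unfolding AE_all_countable
proof
  fix k
  have Dk: "D k \<in> borel_measurable M"
    using marking by (auto simp: iid_marking_def indep_vars_def)
  have "AE x in distr M borel (D k). 0 < f x"
    unfolding distr_D using f_nonneg by (subst AE_density) (auto simp: ennreal_less_zero_iff)
  then show "AE \<omega> in M. 0 < f (D k \<omega>)"
    using Dk by (subst (asm) AE_distr_iff) auto
qed

theorem error_prob_le:
  "error_prob M f (marked_points T D) \<le>
    (\<integral>\<^sup>+x. min 1 (ennreal lam * emeasure lborel (ml_rivals x)) * ennreal (f x) \<partial>lborel)"
proof -
  let ?\<Gamma> = "{\<phi>. \<exists>d. (0, d) \<in> \<phi> \<and> d \<notin> decoding_region f (fst ` \<phi>) 0}"
  let ?h = "\<lambda>x. min 1 (ennreal lam * emeasure lborel (ml_rivals x)) * ennreal (f x)"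
  let ?c = "\<lambda>k \<tau> d. of_bool (confused k \<tau> d) :: ennreal"
  have c: "(\<lambda>\<omega>. ?c k (\<lambda>j. T j \<omega>) (D k \<omega>)) \<in> borel_measurable M"
    "(\<lambda>\<omega>. ?c k (\<lambda>j. T j \<omega>) d) \<in> borel_measurable M"
    "(\<lambda>d. \<integral>\<^sup>+\<omega>. ?c k (\<lambda>j. T j \<omega>) d \<partial>M) \<in> borel_measurable lborel" for k d
  proof -
    have T: "(\<lambda>\<omega> j. T j \<omega>) \<in> measurable M seq_borel"
      by (intro measurable_PiM_single') auto
    have Dk: "D k \<in> borel_measurable M"
      using marking by (auto simp: iid_marking_def indep_vars_def)
    show "(\<lambda>\<omega>. ?c k (\<lambda>j. T j \<omega>) (D k \<omega>)) \<in> borel_measurable M"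
      "(\<lambda>\<omega>. ?c k (\<lambda>j. T j \<omega>) d) \<in> borel_measurable M"
      using measurable_Pair_compose_split[OF measurable_confused T Dk]
        measurable_Pair_compose_split[OF measurable_confused T measurable_const] by simp_all
    have "(\<lambda>(d, \<omega>). ?c k (\<lambda>j. T j \<omega>) d) \<in> borel_measurable (borel \<Otimes>\<^sub>M M)"
      using measurable_Pair_compose_split[OF measurable_confused measurable_compose[OF measurable_snd T] measurable_fst]
      by (simp add: split_beta')
    then show "(\<lambda>d. \<integral>\<^sup>+\<omega>. ?c k (\<lambda>j. T j \<omega>) d \<partial>M) \<in> borel_measurable lborel"
      using borel_measurable_nn_integral by (simp add: split_beta')
  qed
  have h: "?h \<in> borel_measurable lborel"
  proof -
    have "{x \<in> space (borel \<Otimes>\<^sub>M borel). f (fst x) \<le> f (fst x - snd x) \<and> \<not> snd x \<in> core}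
        \<in> sets (borel \<Otimes>\<^sub>M borel)"
      by measurable
    then have "(\<lambda>x. emeasure lborel (Pair x -` {x. f (fst x) \<le> f (fst x - snd x) \<and> \<not> snd x \<in> core}))
        \<in> borel_measurable borel"
      by (intro lborel.measurable_emeasure_Pair) (simp add: space_pair_measure cong: sets_pair_measure_cong)
    moreover have eq: "Pair x -` {x. f (fst x) \<le> f (fst x - snd x) \<and> \<not> snd x \<in> core} = ml_rivals x" for x
      by (auto simp: ml_rivals_def)
    ultimately have [measurable]: "(\<lambda>x. emeasure lborel (ml_rivals x)) \<in> borel_measurable borel"
      unfolding eq by blast
    show ?thesis by measurable
  qed
  have "(\<integral>\<^sup>+\<omega>. (\<integral>\<^sup>+(t, d). indicator (cbox 0 One) t * indicator ?\<Gamma> (recentre t (marked_points T D \<omega>))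
        \<partial>count_space (marked_points T D \<omega>)) \<partial>M) \<le>
      (\<integral>\<^sup>+\<omega>. (\<Sum>k. ?c k (\<lambda>j. T j \<omega>) (D k \<omega>)) \<partial>M)"
  proof (rule nn_integral_mono_AE)
    show "AE \<omega> in M. (\<integral>\<^sup>+(t, d). indicator (cbox 0 One) t * indicator ?\<Gamma> (recentre t (marked_points T D \<omega>))
        \<partial>count_space (marked_points T D \<omega>)) \<le> (\<Sum>k. ?c k (\<lambda>j. T j \<omega>) (D k \<omega>))"
      using AE_enumeration AE_density_pos AE_space
    proof eventually_elim
      case (elim \<omega>)
      then have \<omega>: "\<omega> \<in> space M" "inj (\<lambda>k. T k \<omega>)" "range (\<lambda>k. T k \<omega>) = matern f \<xi> (N \<omega>)"
        "\<And>k. 0 < f (D k \<omega>)"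
        by auto
      have "bij_betw (\<lambda>k. (T k \<omega>, D k \<omega>)) UNIV (marked_points T D \<omega>)"
        using \<omega>(2) by (auto simp: bij_betw_def marked_points_def inj_on_def)
      then have "(\<integral>\<^sup>+(t, d). indicator (cbox 0 One) t * indicator ?\<Gamma> (recentre t (marked_points T D \<omega>))
          \<partial>count_space (marked_points T D \<omega>)) =
        (\<integral>\<^sup>+k. indicator cube (T k \<omega>) * indicator ?\<Gamma> (recentre (T k \<omega>) (marked_points T D \<omega>))
          \<partial>count_space UNIV)"
        by (subst nn_integral_bij_count_space[symmetric]) (auto simp: cube_def)
      also have "\<dots> \<le> (\<integral>\<^sup>+k. ?c k (\<lambda>j. T j \<omega>) (D k \<omega>) \<partial>count_space UNIV)"
      proof (rule nn_integral_mono)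
        fix k
        show "indicator cube (T k \<omega>) * indicator ?\<Gamma> (recentre (T k \<omega>) (marked_points T D \<omega>)) \<le>
            ?c k (\<lambda>j. T j \<omega>) (D k \<omega>)"
          using error_imp_confused[OF \<omega>(1-3) \<omega>(4)[of k]] by (auto simp: indicator_def)
      qed
      finally show ?case
        by (simp add: nn_integral_count_space_nat)
    qed
  qed
  also have "\<dots> = (\<Sum>k. \<integral>\<^sup>+d. (\<integral>\<^sup>+\<omega>. ?c k (\<lambda>j. T j \<omega>) d \<partial>M) * ennreal (f d) \<partial>lborel)"
    using c(1) by (subst nn_integral_suminf) (auto simp: nn_integral_marked[OF measurable_confused])
  also have "\<dots> = (\<integral>\<^sup>+d. (\<Sum>k. (\<integral>\<^sup>+\<omega>. ?c k (\<lambda>j. T j \<omega>) d \<partial>M) * ennreal (f d)) \<partial>lborel)"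
    using c(3) by (intro nn_integral_suminf[symmetric] borel_measurable_times) auto
  also have "\<dots> = (\<integral>\<^sup>+d. (\<integral>\<^sup>+\<omega>. (\<Sum>k. ?c k (\<lambda>j. T j \<omega>) d) \<partial>M) * ennreal (f d) \<partial>lborel)"
    using c(2) by (simp add: nn_integral_suminf)
  also have "\<dots> \<le> (\<integral>\<^sup>+d. \<Lambda> * ?h d \<partial>lborel)"
  proof (rule nn_integral_mono)
    fix d
    show "(\<integral>\<^sup>+\<omega>. (\<Sum>k. ?c k (\<lambda>j. T j \<omega>) d) \<partial>M) * ennreal (f d) \<le> \<Lambda> * ?h d"
    proof (cases "f d = 0")
      case False
      then show ?thesis
        using mult_right_mono[OF expected_confused_le[of d], of "ennreal (f d)"] f_nonneg[of d]
        by (simp add: mult.assoc)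
    qed simp
  qed
  also have "\<dots> = \<Lambda> * (\<integral>\<^sup>+d. ?h d \<partial>lborel)"
    using h by (rule nn_integral_cmult)
  finally have "error_prob M f (marked_points T D) \<le> \<Lambda> * (\<integral>\<^sup>+d. ?h d \<partial>lborel) / \<Lambda>"
    unfolding error_prob_def palm_prob_def intensity_eq by (intro divide_right_mono_ennreal)
  also have "\<dots> = (\<integral>\<^sup>+d. ?h d \<partial>lborel)"
    unfolding mult.commute[of \<Lambda>] using lam_pos
    by (intro ennreal_mult_divide_eq) (simp_all add: \<Lambda>_def)
  finally show ?thesis .
qed

end

theorem mainTheorem8:
  fixes P :: "'v measure" and X :: "nat \<Rightarrow> 'v \<Rightarrow> real" and idx :: "'n::finite \<Rightarrow> nat"
    and f :: "real ^ 'n \<Rightarrow> real" and \<xi> lam :: real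
    and M :: "'w measure" and N :: "'w \<Rightarrow> (real ^ 'n) set"
    and T D :: "nat \<Rightarrow> 'w \<Rightarrow> real ^ 'n"
  assumes "prob_space P"
    and "centered_process P X" and "stationary_process P X" and "ergodic_process P X"
    and "bij_betw idx UNIV {1..CARD('n)}"
    and "\<And>x. 0 \<le> f x"
    and "distributed P lborel (\<lambda>v. \<chi> i. X (idx i) v) (\<lambda>x. ennreal (f x))"
    and "\<And>x. f x = f (- x)"
    and "prob_space M" and "lam > 0"
    and "poisson_process M lam N"
    and "iid_marking M (\<lambda>\<omega>. matern f \<xi> (N \<omega>)) (distr P borel (\<lambda>v. \<chi> i. X (idx i) v)) T D"
  shows "error_prob M f (marked_points T D)
    \<le> (\<integral>\<^sup>+x. min 1 (ennreal lam *
          (\<integral>\<^sup>+y. indicator {y. DD f y 0 \<ge> ereal \<xi>} y * indicator {y. DD f x y \<le> DD f x 0} y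
             \<partial>lborel)) * ennreal (f x) \<partial>lborel)"
proof -
  let ?X = "\<lambda>v. \<chi> i. X (idx i) v"
  have X: "distr P lborel ?X = density lborel (\<lambda>x. ennreal (f x))" "?X \<in> measurable P lborel"
    "(\<lambda>x. ennreal (f x)) \<in> borel_measurable lborel"
    using assms(7) by (auto simp: distributed_def)
  have "(\<lambda>x. enn2real (ennreal (f x))) \<in> borel_measurable borel"
    using X(3) by simp
  then have f: "f \<in> borel_measurable borel"
    using assms(6) by simp
  have "prob_space (distr P lborel ?X)"
    using assms(1) X(2) by (rule prob_space.prob_space_distr)
  then have "emeasure (density lborel (\<lambda>x. ennreal (f x))) UNIV = 1"
    unfolding X(1) using prob_space.emeasure_space_1 by fastforce
  then have "(\<integral>\<^sup>+x. ennreal (f x) \<partial>lborel) = 1"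
    using X(3) by (simp add: emeasure_density)
  moreover have "distr P borel ?X = density lborel (\<lambda>x. ennreal (f x))"
    using X(1) by (simp cong: distr_cong)
  ultimately interpret matern_channel M lam N f \<xi> T D
    using assms(6,12) f
    by (intro matern_channel.intro poisson.intro poisson_axioms.intro matern_channel_axioms.intro
        assms(9,10,11) assms(8)[symmetric]) simp_all
  have "error_prob M f (marked_points T D) \<le>
      (\<integral>\<^sup>+x. min 1 (ennreal lam * emeasure lborel (ml_rivals x)) * ennreal (f x) \<partial>lborel)"
    by (rule error_prob_le)
  also have "\<dots> = (\<integral>\<^sup>+x. min 1 (ennreal lam *
          (\<integral>\<^sup>+y. indicator {y. DD f y 0 \<ge> ereal \<xi>} y * indicator {y. DD f x y \<le> DD f x 0} y
             \<partial>lborel)) * ennreal (f x) \<partial>lborel)"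
  proof (rule nn_integral_cong)
    fix x :: "real ^ 'n"
    show "min 1 (ennreal lam * emeasure lborel (ml_rivals x)) * ennreal (f x) =
      min 1 (ennreal lam *
          (\<integral>\<^sup>+y. indicator {y. DD f y 0 \<ge> ereal \<xi>} y * indicator {y. DD f x y \<le> DD f x 0} y
             \<partial>lborel)) * ennreal (f x)"
    proof (cases "f x = 0")
      case False
      then have pos: "0 < f x"
        using assms(6)[of x] by simp
      have iff: "DD f x y \<le> DD f x 0 \<longleftrightarrow> f x \<le> f (x - y)" for y
        using pos assms(6)[of "x - y"] by (auto simp: DD_def divide_le_cancel)
      have "DD f y 0 \<ge> ereal \<xi> \<longleftrightarrow> y \<notin> core" for y
        using DD_less_\<xi>_iff[of y 0] f_even[of y] by (simp add: core_def not_less[symmetric])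
      then have "(\<integral>\<^sup>+y. indicator {y. DD f y 0 \<ge> ereal \<xi>} y * indicator {y. DD f x y \<le> DD f x 0} y
          \<partial>lborel) = (\<integral>\<^sup>+y. indicator (ml_rivals x) y \<partial>lborel)"
        by (intro nn_integral_cong) (auto simp: ml_rivals_def iff indicator_def)
      also have "\<dots> = emeasure lborel (ml_rivals x)"
        using f by (intro nn_integral_indicator) (simp add: ml_rivals_def)
      finally show ?thesis by simp
    qed simp
  qed
  finally show ?thesis .
qed

end
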